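(* Let $\mathbf{f}=(f_1,\dots,f_m)$ be a polynomial system in $\mathbb{C}[X_1,\dots,X_n]$ and let $\xi=(\xi_1,\dots,\xi_n)\in\mathbb{C}^n$ be a common zero of $\mathbf{f}$. Let $\gamma_0,\dots,\gamma_N,L\in\mathbb{Q}$ be such that $0=\gamma_0<\dots<\gamma_N\le L$, and let $$\Theta=\Big(t,\ \sum_{i=0}^N a_{i2}(t-\xi_1)^{\gamma_i},\ \dots,\ \sum_{i=0}^N a_{in}(t-\xi_1)^{\gamma_i}\Big)$$ be a vector of (truncated) Puiseux series with coefficients in $\mathbb{C}$ centered at $\xi_1$ such that $a_{0l}=\xi_l$ for all $2\le l\le n$ and $\mathrm{ord}_{(t-\xi_1)}(f_j(\Theta))>L$ for all $1\le j\le m$. Assume that $\mathbf{f}$ does not vanish identically at $\Theta$, i.e. $f_j(\Theta)\neq 0$ for at least one $j$. Let $e(\mathbf{f})$ be the Noether exponent of the ideal $\langle f_1,\dots,f_m\rangle$. If $L\ge e(\mathbf{f})$, then there exists an irreducible component $W$ of $V(\mathbf{f})$ with free variable $X_1$ such that $\xi\in W$.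
   Context: $V(\mathbf{f})=V(f_1,\dots,f_m)\subset\mathbb{C}^n$ denotes the set of common zeros of $f_1,\dots,f_m$. A Puiseux series with complex coefficients centered at $\xi_1\in\mathbb{C}$ is a formal expression $\sum_{i\in\mathbb{N}_0}a_i(t-\xi_1)^{\gamma_i}$ with $a_i\in\mathbb{C}$ and $\{\gamma_i\}_{i\in\mathbb{N}_0}$ a strictly increasing family of rational numbers with bounded denominators. Its order is $\mathrm{ord}_{(t-\xi_1)}\big(\sum_i a_i(t-\xi_1)^{\gamma_i}\big)=\min\{\gamma_i\mid a_i\neq 0\}$, with the convention that the zero series has order $+\infty$. $\mathbb{C}\{\{t-\xi_1\}\}$ denotes the ring of all such series; $t$ is regarded as the element $\xi_1+(t-\xi_1)$ of it, so $f_j(\Theta)\in\mathbb{C}\{\{t-\xi_1\}\}$. The Noether exponent $e(\mathbf{f})$ of the ideal $\langle f_1,\dots,f_m\rangle$ is the minimum positive integer $e$ such that $\big(\sqrt{\langle f_1,\dots,f_m\rangle}\big)^{e}\subset\langle f_1,\dots,f_m\rangle$. Let $\pi_{X_1}:\mathbb{C}^n\to\mathbb{C}$, $\pi_{X_1}(x_1,\dots,x_n)=x_1$. An irreducible variety $C\subset\mathbb{C}^n$ is said to be a variety with free variable $X_1$ if $\overline{\pi_{X_1}(C)}=\mathbb{C}$, where the closure is taken in the Zariski topology. *)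

theory Defs
  imports
    "HOL-Analysis.Analysis"
    "HOL-Library.Poly_Mapping"
    "HOL-Library.Extended"
    "HOL-Computational_Algebra.Formal_Laurent_Series"
begin

unbundle no Formal_Power_Series.fps_syntax

section \<open>Polynomials and their evaluation\<close>

text \<open>
  The variables are indexed by a finite type \<open>'n\<close>, so \<open>'n mpoly\<close> is the
  polynomial ring \<open>\<complex>[X\<^sub>1,\<dots>,X\<^sub>n]\<close> with \<open>n = CARD('n)\<close>; its ring structure is the
  convolution product on finitely supported functions from monomials to coefficients.
\<close>

type_synonym 'n mpoly = "('n \<Rightarrow>\<^sub>0 nat) \<Rightarrow>\<^sub>0 complex"

text \<open>
  Evaluation at a point with coordinates in a ring \<open>'r\<close> into which the coefficients are
  mapped by \<open>\<iota>\<close>.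
\<close>

definition eval_mpoly :: "(complex \<Rightarrow> 'r) \<Rightarrow> ('n::finite \<Rightarrow> 'r) \<Rightarrow> 'n mpoly \<Rightarrow> 'r::comm_ring_1"
  where "eval_mpoly \<iota> x p =
    (\<Sum>m\<in>Poly_Mapping.keys p. \<iota> (Poly_Mapping.lookup p m) * (\<Prod>i\<in>UNIV. x i ^ Poly_Mapping.lookup m i))"

abbreviation eval_pt :: "'n::finite mpoly \<Rightarrow> complex ^ 'n \<Rightarrow> complex"
  where "eval_pt p x \<equiv> eval_mpoly (\<lambda>c. c) (\<lambda>i. x $ i) p"

lemma eval_mpoly_superset:
  assumes "finite F" "Poly_Mapping.keys p \<subseteq> F" "\<iota> 0 = 0"
  shows "eval_mpoly \<iota> x p =
    (\<Sum>m\<in>F. \<iota> (Poly_Mapping.lookup p m) * (\<Prod>i\<in>UNIV. x i ^ Poly_Mapping.lookup m i))"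
  unfolding eval_mpoly_def
  by (rule sum.mono_neutral_left) (use assms in \<open>auto simp: in_keys_iff\<close>)

lemma eval_mpoly_add:
  assumes "\<And>a b. \<iota> (a + b) = \<iota> a + \<iota> b"
  shows "eval_mpoly \<iota> x (p + q) = eval_mpoly \<iota> x p + eval_mpoly \<iota> x q"
proof -
  have 0: "\<iota> 0 = 0" using assms[of 0 0] by simp
  let ?F = "Poly_Mapping.keys p \<union> Poly_Mapping.keys q"
  have "eval_mpoly \<iota> x r =
      (\<Sum>m\<in>?F. \<iota> (Poly_Mapping.lookup r m) * (\<Prod>i\<in>UNIV. x i ^ Poly_Mapping.lookup m i))"
    if "r \<in> {p, q, p + q}" for r
    by (rule eval_mpoly_superset) (use that 0 keys_add[of p q] in auto)
  then show ?thesis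
    by (simp add: lookup_add assms sum.distrib distrib_right)
qed

lemma eval_mpoly_single:
  assumes "\<iota> 0 = 0"
  shows "eval_mpoly \<iota> x (Poly_Mapping.single m c) = \<iota> c * (\<Prod>i\<in>UNIV. x i ^ Poly_Mapping.lookup m i)"
  using eval_mpoly_superset[of "{m}" "Poly_Mapping.single m c" \<iota> x] assms by simp

lemma mpoly_induct [case_names single add]:
  assumes "\<And>m c. P (Poly_Mapping.single m c)" "\<And>p q. P p \<Longrightarrow> P q \<Longrightarrow> P (p + q)"
  shows "P (p :: 'n mpoly)"
proof -
  have "P (\<Sum>m\<in>F. Poly_Mapping.single m (Poly_Mapping.lookup p m))" if "finite F" for F
    using that
  proof induction
    case empty
    then show ?case using assms(1)[of 0 0] by simp
  qed (use assms in auto)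
  then have "P (\<Sum>m\<in>Poly_Mapping.keys p. Poly_Mapping.single m (Poly_Mapping.lookup p m))"
    by simp
  moreover have "(\<Sum>m\<in>Poly_Mapping.keys p. Poly_Mapping.single m (Poly_Mapping.lookup p m)) = p"
  proof (rule poly_mapping_eqI)
    fix k
    have "Poly_Mapping.lookup
        (\<Sum>m\<in>Poly_Mapping.keys p. Poly_Mapping.single m (Poly_Mapping.lookup p m)) k
      = (\<Sum>m\<in>Poly_Mapping.keys p. if m = k then Poly_Mapping.lookup p k else 0)"
      unfolding lookup_sum by (rule sum.cong) (auto simp: lookup_single when_def)
    also have "\<dots> = Poly_Mapping.lookup p k" by (simp add: in_keys_iff)
    finally show "Poly_Mapping.lookup
        (\<Sum>m\<in>Poly_Mapping.keys p. Poly_Mapping.single m (Poly_Mapping.lookup p m)) k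
      = Poly_Mapping.lookup p k" .
  qed
  ultimately show ?thesis by simp
qed

lemma eval_mpoly_mult:
  assumes add: "\<And>a b. \<iota> (a + b) = \<iota> a + \<iota> b" and mult: "\<And>a b. \<iota> (a * b) = \<iota> a * \<iota> b"
  shows "eval_mpoly \<iota> x (p * q) = eval_mpoly \<iota> x p * eval_mpoly \<iota> x q"
proof -
  have 0: "\<iota> 0 = 0" using add[of 0 0] by simp
  show ?thesis
  proof (induction p rule: mpoly_induct)
    case (single m c)
    show ?case
    proof (induction q rule: mpoly_induct)
      case (single m' c')
      then show ?case
        by (simp add: mult_single eval_mpoly_single 0 mult lookup_add power_add prod.distrib mult_ac)
    next
      case (add p q)
      then show ?case by (simp add: distrib_left eval_mpoly_add assms)
    qed
  next
    case (add p q)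
    then show ?case by (simp add: distrib_right eval_mpoly_add assms)
  qed
qed


section \<open>Ideals and the Noether exponent\<close>

text \<open>An ideal of a commutative ring is a submodule of the ring over itself.\<close>

lemma module_mult: "module ((*) :: 'a::comm_ring_1 \<Rightarrow> 'a \<Rightarrow> 'a)"
  by unfold_locales (simp_all add: algebra_simps)

definition ideal_gen :: "'a::comm_ring_1 set \<Rightarrow> 'a set"
  where "ideal_gen S = module.span (*) S"

definition radical :: "'a::comm_ring_1 set \<Rightarrow> 'a set"
  where "radical I = {p. \<exists>k>0. p ^ k \<in> I}"

definition ideal_power :: "'a::comm_ring_1 set \<Rightarrow> nat \<Rightarrow> 'a set"
  where "ideal_power I e = ideal_gen {\<Prod>i<e. g i | g. \<forall>i<e. g i \<in> I}"

text \<open>In a Noetherian ring the set of admissible exponents is nonempty, so \<open>LEAST\<close> is a minimum.\<close>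

definition noether_exponent :: "'a::comm_ring_1 set \<Rightarrow> nat"
  where "noether_exponent I = (LEAST e. e > 0 \<and> ideal_power (radical I) e \<subseteq> I)"


section \<open>Zariski topology, irreducible varieties\<close>

definition zero_set :: "'n::finite mpoly set \<Rightarrow> (complex ^ 'n) set"
  where "zero_set F = {x. \<forall>p\<in>F. eval_pt p x = 0}"

definition zariski :: "(complex ^ 'n::finite) topology"
  where "zariski = topology (\<lambda>U. \<exists>F. U = - zero_set F)"

text \<open>The Zariski topology on the affine line.\<close>

definition zariski_line :: "complex topology"
  where "zariski_line = topology (\<lambda>U. \<exists>F. U = - {x. \<forall>p\<in>F. poly p x = 0})"

lemma istopology_zeros:
  fixes ev :: "'p \<Rightarrow> 'a \<Rightarrow> complex"
  assumes "\<And>p q. \<exists>r. \<forall>x. ev r x = ev p x * ev q x"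
  shows "istopology (\<lambda>U. \<exists>F. U = - {x. \<forall>p\<in>F. ev p x = 0})"
  unfolding istopology_def
proof (intro conjI allI impI)
  fix S T
  assume "\<exists>F. S = - {x. \<forall>p\<in>F. ev p x = 0}" "\<exists>F. T = - {x. \<forall>p\<in>F. ev p x = 0}"
  then obtain F G where S: "S = - {x. \<forall>p\<in>F. ev p x = 0}" and T: "T = - {x. \<forall>p\<in>G. ev p x = 0}"
    by blast
  define r where "r p q = (SOME r. \<forall>x. ev r x = ev p x * ev q x)" for p q
  have r: "ev (r p q) x = ev p x * ev q x" for p q x
    unfolding r_def using someI_ex[OF assms[of p q]] by blast
  have "S \<inter> T = - {x. \<forall>p\<in>{r p q | p q. p \<in> F \<and> q \<in> G}. ev p x = 0}"
  proof -
    have "x \<in> S \<inter> T \<longleftrightarrow> (\<exists>p\<in>F. \<exists>q\<in>G. ev (r p q) x \<noteq> 0)" for x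
      unfolding S T r by auto
    then show ?thesis by blast
  qed
  then show "\<exists>F. S \<inter> T = - {x. \<forall>p\<in>F. ev p x = 0}" by blast
next
  fix K
  assume "\<forall>S\<in>K. \<exists>F. S = - {x. \<forall>p\<in>F. ev p x = 0}"
  then obtain F where F: "\<And>S. S \<in> K \<Longrightarrow> S = - {x. \<forall>p\<in>F S. ev p x = 0}"
    by (auto dest!: bchoice)
  have "x \<in> \<Union>K \<longleftrightarrow> (\<exists>S\<in>K. \<exists>p\<in>F S. ev p x \<noteq> 0)" for x
    using F by blast
  then have "\<Union>K = - {x. \<forall>p\<in>(\<Union>S\<in>K. F S). ev p x = 0}" by auto
  then show "\<exists>F. \<Union>K = - {x. \<forall>p\<in>F. ev p x = 0}" by blast
qed

lemma openin_zariski: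
  fixes U :: "(complex ^ 'n::finite) set"
  shows "openin zariski U \<longleftrightarrow> (\<exists>F. U = - zero_set F)"
proof -
  have "istopology (\<lambda>U :: (complex ^ 'n) set. \<exists>F. U = - zero_set F)"
    unfolding zero_set_def
  proof (rule istopology_zeros)
    fix p q :: "'n mpoly"
    show "\<exists>r. \<forall>x. eval_pt r x = eval_pt p x * eval_pt q x"
      by (rule exI[of _ "p * q"]) (simp add: eval_mpoly_mult)
  qed
  then show ?thesis by (simp add: zariski_def)
qed

lemma openin_zariski_line:
  "openin zariski_line U \<longleftrightarrow> (\<exists>F. U = - {x. \<forall>p\<in>F. poly p x = 0})"
proof -
  have "istopology (\<lambda>U. \<exists>F. U = - {x::complex. \<forall>p\<in>F. poly p x = 0})"
  proof (rule istopology_zeros)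
    fix p q :: "complex poly"
    show "\<exists>r. \<forall>x. poly r x = poly p x * poly q x"
      by (rule exI[of _ "p * q"]) simp
  qed
  then show ?thesis by (simp add: zariski_line_def)
qed

lemma closedin_zariski:
  fixes C :: "(complex ^ 'n::finite) set"
  shows "closedin zariski C \<longleftrightarrow> (\<exists>F. C = zero_set F)"
proof -
  have "eval_pt 1 x = 1" for x :: "complex ^ 'n"
    using eval_mpoly_single[of "\<lambda>c. c" "\<lambda>i. x $ i" 0 1] by simp
  then have "zero_set {1 :: 'n mpoly} = {}"
    by (simp add: zero_set_def)
  then have "openin zariski (UNIV :: (complex ^ 'n) set)"
    unfolding openin_zariski by (metis Compl_empty_eq)
  then have "topspace zariski = (UNIV :: (complex ^ 'n) set)"
    using openin_subset by blast
  then have "closedin zariski C \<longleftrightarrow> (\<exists>F. - C = - zero_set F)"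
    by (simp add: closedin_def openin_zariski Compl_eq_Diff_UNIV)
  then show ?thesis by (simp only: compl_eq_compl_iff)
qed

definition irreducible_variety :: "(complex ^ 'n::finite) set \<Rightarrow> bool"
  where "irreducible_variety C \<longleftrightarrow>
    closedin zariski C \<and> C \<noteq> {} \<and>
    (\<forall>A B. closedin zariski A \<and> closedin zariski B \<and> C = A \<union> B \<longrightarrow> C = A \<or> C = B)"

definition irreducible_component :: "(complex ^ 'n::finite) set \<Rightarrow> (complex ^ 'n) set \<Rightarrow> bool"
  where "irreducible_component V W \<longleftrightarrow>
    irreducible_variety W \<and> W \<subseteq> V \<and>
    (\<forall>W'. irreducible_variety W' \<and> W \<subseteq> W' \<and> W' \<subseteq> V \<longrightarrow> W' = W)"

definition has_free_variable :: "'n::finite \<Rightarrow> (complex ^ 'n) set \<Rightarrow> bool"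
  where "has_free_variable i C \<longleftrightarrow>
    irreducible_variety C \<and> zariski_line closure_of ((\<lambda>x. x $ i) ` C) = UNIV"


section \<open>Puiseux series\<close>

text \<open>
  A series is represented by its coefficient function: \<open>c q\<close> is the coefficient of
  \<open>(t - \<xi>\<^sub>1)\<^sup>q\<close>. Being formal, the type does not record the center \<open>\<xi>\<^sub>1\<close>; it only enters
  through the way \<open>t\<close> itself is embedded, namely as \<open>\<xi>\<^sub>1 + (t - \<xi>\<^sub>1)\<close>.
\<close>

definition is_puiseux :: "(rat \<Rightarrow> complex) \<Rightarrow> bool"
  where "is_puiseux c \<longleftrightarrow>
    (\<exists>\<gamma> :: nat \<Rightarrow> rat. strict_mono \<gamma> \<and> (\<exists>B. \<forall>i. snd (quotient_of (\<gamma> i)) \<le> B) \<and>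
      (\<forall>q. c q \<noteq> 0 \<longrightarrow> q \<in> range \<gamma>))"

text \<open>The series obtained from a Laurent series in \<open>s\<close> by \<open>s = (t - \<xi>\<^sub>1)\<^bsup>1/d\<^esup>\<close>.\<close>

definition ramify :: "nat \<Rightarrow> complex fls \<Rightarrow> rat \<Rightarrow> complex"
  where "ramify d f q = (if of_nat d * q \<in> \<int> then fls_nth f \<lfloor>of_nat d * q\<rfloor> else 0)"

lemma ramify_eqI:
  assumes "d > 0" "\<And>q. of_nat d * q \<notin> \<int> \<Longrightarrow> c q = 0" "\<And>n. c (of_int n / of_nat d) = fls_nth f n"
  shows "c = ramify d f"
proof
  fix q
  show "c q = ramify d f q"
  proof (cases "of_nat d * q \<in> \<int>")
    case True
    then obtain n where n: "of_nat d * q = of_int n" by (auto elim: Ints_cases)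
    then have "q = of_int n / of_nat d" using assms(1) by (simp add: field_simps)
    then show ?thesis using assms n by (simp add: ramify_def)
  qed (use assms in \<open>auto simp: ramify_def\<close>)
qed

lemma ramify_nth: "d > 0 \<Longrightarrow> ramify d f (of_int n / of_nat d) = fls_nth f n"
  by (simp add: ramify_def)

lemma is_puiseux_ramify:
  assumes "d > 0"
  shows "is_puiseux (ramify d f)"
proof -
  obtain K where K: "\<forall>n<K. fls_nth f n = 0" by (elim fls_nth_vanishes_belowE)
  define \<gamma> :: "nat \<Rightarrow> rat" where "\<gamma> i = of_int (K + int i) / of_nat d" for i
  have "strict_mono \<gamma>"
    using assms by (auto simp: strict_mono_def \<gamma>_def divide_strict_right_mono)
  moreover have "snd (quotient_of (\<gamma> i)) \<le> int d" for i
  proof -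
    have "\<gamma> i = Fract (K + int i) (int d)" by (simp add: \<gamma>_def Fract_of_int_quotient)
    then have "snd (quotient_of (\<gamma> i)) = int d div gcd (K + int i) (int d)"
      using assms by (simp add: quotient_of_Fract Rat.normalize_def Let_def)
    also have "\<dots> \<le> int d"
      by (metis dvd_div_mult_self gcd_dvd2 zdvd_imp_le dvd_triv_left of_nat_0_less_iff assms)
    finally show ?thesis .
  qed
  moreover have "q \<in> range \<gamma>" if "ramify d f q \<noteq> 0" for q
  proof -
    from that have "of_nat d * q \<in> \<int>" and nz: "fls_nth f \<lfloor>of_nat d * q\<rfloor> \<noteq> 0"
      by (auto simp: ramify_def split: if_splits)
    then obtain n where n: "of_nat d * q = of_int n" by (auto elim: Ints_cases)
    with nz K have "K \<le> n" by (metis floor_of_int not_less)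
    moreover have "q = of_int n / of_nat d" using n assms by (simp add: field_simps)
    ultimately have "q = \<gamma> (nat (n - K))" by (simp add: \<gamma>_def)
    then show ?thesis by blast
  qed
  ultimately show ?thesis unfolding is_puiseux_def by blast
qed

lemma is_puiseux_iff: "is_puiseux c \<longleftrightarrow> (\<exists>d f. d > 0 \<and> c = ramify d f)"
proof
  assume "is_puiseux c"
  then obtain \<gamma> :: "nat \<Rightarrow> rat" and B where \<gamma>: "strict_mono \<gamma>"
    and B: "\<And>i. snd (quotient_of (\<gamma> i)) \<le> B" and c: "\<And>q. c q \<noteq> 0 \<Longrightarrow> q \<in> range \<gamma>"
    unfolding is_puiseux_def by blast
  define d :: nat where "d = fact (nat B)"
  have d: "d > 0" by (simp add: d_def)
  have Int: "of_nat d * \<gamma> i \<in> \<int>" for i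
  proof -
    obtain a b where ab: "quotient_of (\<gamma> i) = (a, b)" by fastforce
    then have b: "b > 0" "b \<le> B" and g: "\<gamma> i = of_int a / of_int b"
      using B[of i] quotient_of_denom_pos quotient_of_div by auto
    have "nat b dvd d" unfolding d_def by (rule dvd_fact) (use b in auto)
    then obtain k where k: "d = nat b * k" by blast
    have "(of_nat d :: rat) = of_int b * of_nat k" using b by (simp add: k)
    then have "of_nat d * \<gamma> i = of_int (a * int k)" using b by (simp add: g)
    then show ?thesis by (metis Ints_of_int)
  qed
  define f where "f = Abs_fls (\<lambda>n. c (of_int n / of_nat d))"
  have low: "c q = 0" if "q < \<gamma> 0" for q
  proof (rule ccontr)
    assume "c q \<noteq> 0"
    then obtain i where "q = \<gamma> i" using c by blast
    with that have "i < 0" using strict_mono_less[OF \<gamma>] by blast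
    then show False by simp
  qed
  have "\<forall>n < \<lfloor>of_nat d * \<gamma> 0\<rfloor>. c (of_int n / of_nat d) = 0"
    using d by (auto intro!: low simp: less_floor_iff field_simps)
  then have "fls_nth f n = c (of_int n / of_nat d)" for n
    unfolding f_def by (intro nth_Abs_fls_lower_bound) blast
  then have "c = ramify d f"
    by (intro ramify_eqI d) (use c Int in auto)
  with d show "\<exists>d f. d > 0 \<and> c = ramify d f" by blast
qed (auto simp: is_puiseux_ramify)

lemma ramify_compose_power:
  assumes "d > 0" "k > 0"
  shows "ramify d f = ramify (d * k) (fls_compose_power f k)"
proof (rule ramify_eqI)
  show "ramify d f q = 0" if "of_nat (d * k) * q \<notin> \<int>" for q
  proof -
    have "of_nat d * q \<notin> \<int>"
    proof
      assume "of_nat d * q \<in> \<int>"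
      then have "of_nat k * (of_nat d * q) \<in> \<int>" by (rule Ints_mult[OF Ints_of_nat])
      with that show False by (simp add: mult_ac)
    qed
    then show ?thesis by (simp add: ramify_def)
  qed
  show "ramify d f (of_int n / of_nat (d * k)) = fls_nth (fls_compose_power f k) n" for n
  proof (cases "int k dvd n")
    case True
    then obtain j where j: "n = int k * j" by blast
    have "(of_int n :: rat) / of_nat (d * k) = of_int j / of_nat d"
      using assms by (simp add: j)
    then show ?thesis using assms j
      by (simp add: ramify_nth fls_nth_compose_power del: of_nat_mult)
  next
    case False
    have "of_nat d * (of_int n / of_nat (d * k)) \<notin> (\<int> :: rat set)"
    proof
      assume "of_nat d * (of_int n / of_nat (d * k)) \<in> (\<int> :: rat set)"
      then obtain j where "of_nat d * (of_int n / of_nat (d * k)) = (of_int j :: rat)"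
        by (auto elim: Ints_cases)
      then have "(of_int n :: rat) = of_int (int k * j)" using assms by (simp add: field_simps)
      then have "n = int k * j" by (simp only: of_int_eq_iff)
      with False show False by simp
    qed
    then show ?thesis using False assms by (simp add: ramify_def fls_nth_compose_power)
  qed
qed (use assms in auto)

lemma common_ramify:
  assumes "is_puiseux a" "is_puiseux b"
  obtains d f g where "d > 0" "a = ramify d f" "b = ramify d g"
proof -
  from assms obtain d d' f g where "d > 0" "d' > 0" "a = ramify d f" "b = ramify d' g"
    unfolding is_puiseux_iff by blast
  then show ?thesis
    using that[of "d * d'" "fls_compose_power f d'" "fls_compose_power g d"]
      ramify_compose_power[of d d' f] ramify_compose_power[of d' d g]
    by (simp add: mult.commute)
qed

lemma ramify_add: "ramify d (f + g) = (\<lambda>q. ramify d f q + ramify d g q)"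
  and ramify_uminus: "ramify d (- f) = (\<lambda>q. - ramify d f q)"
  by (auto simp: ramify_def fun_eq_iff)

text \<open>The sum below is finite for Puiseux series.\<close>

definition conv :: "(rat \<Rightarrow> complex) \<Rightarrow> (rat \<Rightarrow> complex) \<Rightarrow> rat \<Rightarrow> complex"
  where "conv a b q = (\<Sum>r | a r \<noteq> 0 \<and> b (q - r) \<noteq> 0. a r * b (q - r))"

lemma conv_ramify:
  assumes "d > 0"
  shows "conv (ramify d f) (ramify d g) = ramify d (f * g)"
proof (rule ramify_eqI)
  have supp: "of_nat d * r \<in> \<int>" if "ramify d h r \<noteq> 0" for h r
    using that by (auto simp: ramify_def split: if_splits)
  show "conv (ramify d f) (ramify d g) q = 0" if "of_nat d * q \<notin> \<int>" for q
  proof -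
    have "ramify d f r = 0 \<or> ramify d g (q - r) = 0" for r
    proof (rule ccontr)
      assume "\<not> ?thesis"
      then have "of_nat d * r + of_nat d * (q - r) \<in> \<int>"
        by (intro Ints_add) (auto intro: supp)
      with that show False by (simp add: algebra_simps)
    qed
    then show ?thesis by (auto simp: conv_def intro!: sum.neutral)
  qed
  fix n
  let ?D = "\<lambda>k::int. of_int k / (of_nat d :: rat)"
  let ?I = "{fls_subdegree f..n - fls_subdegree g}"
  have inj: "inj_on ?D ?I" using assms by (auto simp: inj_on_def)
  have sub: "{r. ramify d f r \<noteq> 0 \<and> ramify d g (?D n - r) \<noteq> 0} \<subseteq> ?D ` ?I"
  proof
    fix r
    assume "r \<in> {r. ramify d f r \<noteq> 0 \<and> ramify d g (?D n - r) \<noteq> 0}"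
    then have nz: "ramify d f r \<noteq> 0" "ramify d g (?D n - r) \<noteq> 0" by auto
    from supp[OF nz(1)] obtain k where "of_nat d * r = of_int k" by (auto elim: Ints_cases)
    then have r: "r = ?D k" using assms by (simp add: field_simps)
    have *: "?D n - r = ?D (n - k)" by (simp add: r diff_divide_distrib)
    have "fls_nth f k \<noteq> 0" using nz(1) assms by (simp add: r ramify_nth)
    moreover have "fls_nth g (n - k) \<noteq> 0"
      using nz(2) assms unfolding * by (simp only: ramify_nth not_False_eq_True)
    ultimately have "k \<ge> fls_subdegree f" "n - k \<ge> fls_subdegree g"
      by (auto intro: fls_subdegree_leI)
    then show "r \<in> ?D ` ?I" using r by auto
  qed
  have "conv (ramify d f) (ramify d g) (?D n)
      = (\<Sum>r\<in>?D ` ?I. ramify d f r * ramify d g (?D n - r))"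
    unfolding conv_def by (rule sum.mono_neutral_left) (use sub in auto)
  also have "\<dots> = (\<Sum>k\<in>?I. ramify d f (?D k) * ramify d g (?D n - ?D k))"
    by (simp add: sum.reindex[OF inj])
  also have "\<dots> = (\<Sum>k\<in>?I. fls_nth f k * fls_nth g (n - k))"
    using assms by (simp only: ramify_nth flip: diff_divide_distrib of_int_diff)
  also have "\<dots> = fls_nth (f * g) n" by (simp add: fls_times_nth(2))
  finally show "conv (ramify d f) (ramify d g) (?D n) = fls_nth (f * g) n" .
qed (use assms in auto)

typedef puiseux = "{c. is_puiseux c}"
  morphisms puiseux_coeff Abs_puiseux
  using is_puiseux_ramify[of 1] by auto

setup_lifting type_definition_puiseux

lemma is_puiseux_single: "is_puiseux (\<lambda>q. if q = r then c else 0)"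
proof -
  obtain a b where ab: "quotient_of r = (a, b)" by fastforce
  then have b: "b > 0" and r: "r = of_int a / of_int b"
    using quotient_of_denom_pos quotient_of_div by auto
  have "(\<lambda>q. if q = r then c else 0) = ramify (nat b) (fls_shift (- a) (fls_const c))"
  proof (rule ramify_eqI)
    show "(if q = r then c else 0) = 0" if "of_nat (nat b) * q \<notin> \<int>" for q
      using that b r by auto
    show "(if of_int n / of_nat (nat b) = r then c else 0) = fls_nth (fls_shift (- a) (fls_const c)) n" for n
      using b by (auto simp: r field_simps)
  qed (use b in auto)
  then show ?thesis using b is_puiseux_ramify by auto
qed

text \<open>The series \<open>c (t - \<xi>\<^sub>1)\<^sup>r\<close>.\<close>

lift_definition puiseux_monom :: "complex \<Rightarrow> rat \<Rightarrow> puiseux"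
  is "\<lambda>c r q. if q = r then c else 0"
  by (rule is_puiseux_single)

abbreviation puiseux_const :: "complex \<Rightarrow> puiseux"
  where "puiseux_const c \<equiv> puiseux_monom c 0"

instantiation puiseux :: comm_ring_1
begin

lift_definition zero_puiseux :: puiseux is "\<lambda>_. 0"
  using is_puiseux_single[of _ 0] by simp

lift_definition one_puiseux :: puiseux is "\<lambda>q. if q = 0 then 1 else 0"
  by (rule is_puiseux_single)

lift_definition uminus_puiseux :: "puiseux \<Rightarrow> puiseux" is "\<lambda>a q. - a q"
  by (subst (asm) is_puiseux_iff) (auto simp: is_puiseux_ramify simp flip: ramify_uminus)

lift_definition plus_puiseux :: "puiseux \<Rightarrow> puiseux \<Rightarrow> puiseux" is "\<lambda>a b q. a q + b q"
  by (erule (1) common_ramify) (simp add: is_puiseux_ramify flip: ramify_add)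

definition minus_puiseux :: "puiseux \<Rightarrow> puiseux \<Rightarrow> puiseux"
  where "minus_puiseux a b = a + - b"

lift_definition times_puiseux :: "puiseux \<Rightarrow> puiseux \<Rightarrow> puiseux" is conv
  by (erule (1) common_ramify) (simp add: is_puiseux_ramify conv_ramify)

instance
proof
  fix a b c :: puiseux
  have three: "\<exists>d f g h. d > 0 \<and> x = ramify d f \<and> y = ramify d g \<and> z = ramify d h"
    if xyz: "is_puiseux x" "is_puiseux y" "is_puiseux z" for x y z
  proof -
    from xyz(1,2) obtain d f g where d: "d > 0" "x = ramify d f" "y = ramify d g"
      by (rule common_ramify)
    from xyz(3) obtain e h where e: "e > 0" "z = ramify e h" unfolding is_puiseux_iff by blast
    have "z = ramify (d * e) (fls_compose_power h d)"
      unfolding e(2) mult.commute[of d e] by (rule ramify_compose_power[OF e(1) d(1)])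
    moreover have "x = ramify (d * e) (fls_compose_power f e)" "y = ramify (d * e) (fls_compose_power g e)"
      unfolding d(2,3) by (rule ramify_compose_power[OF d(1) e(1)])+
    moreover have "d * e > 0" using d e by simp
    ultimately show ?thesis by blast
  qed
  show "a + b + c = a + (b + c)" by transfer (simp add: add_ac)
  show "a + b = b + a" by transfer (simp add: add_ac)
  show "0 + a = a" by transfer simp
  show "- a + a = 0" by transfer simp
  show "a - b = a + - b" by (rule minus_puiseux_def)
  show "a * b * c = a * (b * c)"
    by transfer (drule (2) three, auto simp: conv_ramify mult.assoc)
  show "(a + b) * c = a * c + b * c"
    by transfer (drule (2) three, auto simp: conv_ramify distrib_right simp flip: ramify_add)
  show "a * b = b * a"
    by transfer (erule (1) common_ramify, simp add: conv_ramify mult.commute)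
  have one: "(\<lambda>q. if q = 0 then 1 else 0) = ramify d 1" if "d > 0" for d
    by (rule ramify_eqI) (use that in auto)
  show "1 * a = a"
    by transfer (auto simp: is_puiseux_iff one conv_ramify)
  show "(0::puiseux) \<noteq> 1"
    by transfer (auto dest: fun_cong[of _ _ 0])
qed

end

lemma puiseux_monom_add: "puiseux_monom (a + b) r = puiseux_monom a r + puiseux_monom b r"
  by transfer auto

lemma puiseux_monom_mult: "puiseux_monom a r * puiseux_monom b s = puiseux_monom (a * b) (r + s)"
proof transfer
  fix a b :: complex and r s :: rat
  have "{x. (if x = r then a else 0) \<noteq> 0 \<and> (if q - x = s then b else 0) \<noteq> 0}
      = (if a \<noteq> 0 \<and> b \<noteq> 0 \<and> q = r + s then {r} else {})" for q
    by auto
  then show "conv (\<lambda>q. if q = r then a else 0) (\<lambda>q. if q = s then b else 0) =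
      (\<lambda>q. if q = r + s then a * b else 0)"
    by (auto simp: conv_def fun_eq_iff)
qed

lemma puiseux_const_one: "puiseux_const 1 = 1"
  by transfer simp

definition puiseux_ord :: "puiseux \<Rightarrow> rat extended"
  where "puiseux_ord a = (if a = 0 then Pinf else Fin (LEAST q. puiseux_coeff a q \<noteq> 0))"

lemma puiseux_ord_eq_Fin_iff:
  "puiseux_ord a = Fin r \<longleftrightarrow>
    puiseux_coeff a r \<noteq> 0 \<and> (\<forall>q. puiseux_coeff a q \<noteq> 0 \<longrightarrow> r \<le> q)"
proof (cases "a = 0")
  case True
  then show ?thesis by (simp add: puiseux_ord_def zero_puiseux.rep_eq)
next
  case False
  let ?P = "\<lambda>q. puiseux_coeff a q \<noteq> 0"
  obtain \<gamma> :: "nat \<Rightarrow> rat" where \<gamma>: "strict_mono \<gamma>" "\<And>q. ?P q \<Longrightarrow> q \<in> range \<gamma>"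
    using puiseux_coeff[of a] unfolding is_puiseux_def by blast
  obtain q0 where "?P q0"
    using False by (metis puiseux_coeff_inject zero_puiseux.rep_eq ext)
  then obtain i where "?P (\<gamma> i)" using \<gamma>(2) by blast
  define j where "j = (LEAST i. ?P (\<gamma> i))"
  have j: "?P (\<gamma> j)" unfolding j_def by (rule LeastI) (rule \<open>?P (\<gamma> i)\<close>)
  have jle: "\<gamma> j \<le> q" if "?P q" for q
  proof -
    from \<gamma>(2)[OF that] obtain k where k: "q = \<gamma> k" by blast
    with that have "j \<le> k" unfolding j_def by (intro Least_le) simp
    then show ?thesis using k strict_mono_less_eq[OF \<gamma>(1)] by simp
  qed
  have "(LEAST q. ?P q) = \<gamma> j"
    by (rule Least_equality) (use j jle in auto)
  then show ?thesis
    using False j jle by (auto simp: puiseux_ord_def intro: antisym)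
qed

end

theory Submission
  imports
    Defs
    "HOL-Computational_Algebra.Fundamental_Theorem_Algebra"
begin

text \<open>
  Suppose that no component of \<open>V = V(f)\<close> through \<open>\<xi>\<close> has \<open>X\<^sub>1\<close> as a free variable. The image of
  an irreducible variety under the first projection is either Zariski dense in the line or a single
  point, so \<open>X\<^sub>1 - \<xi>\<^sub>1\<close> vanishes on every component through \<open>\<xi>\<close>. There are finitely many
  components, so some polynomial \<open>g\<close> vanishes on all the components that miss \<open>\<xi>\<close> but not at
  \<open>\<xi>\<close> itself. Then \<open>u = g (X\<^sub>1 - \<xi>\<^sub>1)\<close> vanishes on \<open>V\<close>, the Nullstellensatz puts \<open>u\<close> into the
  radical of \<open>I = \<langle>f\<^sub>1,\<dots>,f\<^sub>m\<rangle>\<close>, and \<open>u\<^bsup>e\<^esup> \<in> I\<close> for the Noether exponent \<open>e\<close>.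

  Now substitute \<open>\<Theta>\<close>. Its coordinates have no negative exponents and constant term \<open>\<xi>\<close>. Every
  element of \<open>I\<close> is a combination of the \<open>f\<^sub>j\<close> and therefore has order greater than \<open>L\<close> at \<open>\<Theta>\<close>
  (\<open>eval_puiseux_ideal_vanishes\<close>). But \<open>u\<^bsup>e\<^esup>\<close> becomes \<open>g(\<Theta>)\<^bsup>e\<^esup> (t - \<xi>\<^sub>1)\<^bsup>e\<^esup>\<close>, whose coefficient at
  exponent \<open>e\<close> is \<open>g(\<xi>)\<^bsup>e\<^esup> \<noteq> 0\<close>; so its order is exactly \<open>e \<le> L\<close>, a contradiction.

  The commutative algebra behind this is built on the way: Hilbert's basis theorem
  (\<open>hilbert_basis\<close>), which makes the Noether exponent an actual minimum
  (\<open>noether_exponent_attained\<close>) and gives the decomposition into finitely many components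
  (\<open>finite_irreducible_components\<close>), and Hilbert's Nullstellensatz over the complex numbers
  (\<open>nullstellensatz\<close>).
\<close>

section \<open>Ideals\<close>

interpretation ideal: module "(*) :: 'a::comm_ring_1 \<Rightarrow> 'a \<Rightarrow> 'a"
  by (rule module_mult)

(* As a rewrite rule this reassociates products and loops with the rules for commutative rings. *)
declare ideal.scale_scale [simp del]

lemma ideal_mult_right: "ideal.subspace I \<Longrightarrow> x \<in> I \<Longrightarrow> x * r \<in> I" for I :: "'a::comm_ring_1 set"
  using ideal.subspace_scale[of I x r] by (simp add: mult.commute)

section \<open>Monomials and Dickson's lemma\<close>

text \<open>
  A monomial order without any order on the variables: attach a different prime to each variable and
  send a monomial to the corresponding product of prime powers. Unique factorization makes this
  injective, addition of exponents becomes multiplication, and being natural numbers the keys are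
  well-ordered.
\<close>

lemma monomial_key_exists:
  "\<exists>key :: ('n::finite \<Rightarrow>\<^sub>0 nat) \<Rightarrow> nat.
     inj key \<and> (\<forall>a b. key (a + b) = key a * key b) \<and> (\<forall>a. key a > 0)"
proof -
  obtain s :: "nat \<Rightarrow> nat" where s: "inj s" "range s \<subseteq> {p. prime p}"
    using infinite_countable_subset[OF primes_infinite] by blast
  obtain t :: "'n \<Rightarrow> nat" where t: "inj t"
    using finite_imp_inj_to_nat_seg[of "UNIV :: 'n set"] by auto
  define p where "p = s \<circ> t"
  have p_inj: "inj p" and p_prime: "prime (p i)" for i
    using s t by (auto simp: p_def inj_compose)
  define key where "key m = (\<Prod>i\<in>UNIV. p i ^ Poly_Mapping.lookup m i)" for m :: "'n \<Rightarrow>\<^sub>0 nat"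
  have mult: "multiplicity (p i) (key m) = Poly_Mapping.lookup m i" for i m
  proof -
    have "key m = (\<Prod>q\<in>range p. q ^ Poly_Mapping.lookup m (inv p q))"
      by (simp add: key_def prod.reindex[OF p_inj] inv_f_f[OF p_inj])
    also have "multiplicity (p i) \<dots> = Poly_Mapping.lookup m i"
      using p_prime by (subst multiplicity_prod_prime_powers) (auto simp: inv_f_f[OF p_inj])
    finally show ?thesis .
  qed
  have "inj key"
    by (rule injI, rule poly_mapping_eqI) (metis mult)
  moreover have "key (a + b) = key a * key b" for a b
    by (simp add: key_def lookup_add power_add prod.distrib)
  moreover have "key a > 0" for a
    unfolding key_def by (intro prod_pos) (simp add: prime_gt_0_nat[OF p_prime])
  ultimately show ?thesis by blast
qed

lemma nat_incseq_subseq: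
  fixes s :: "nat \<Rightarrow> nat"
  obtains r where "strict_mono r" "incseq (\<lambda>k. s (r k))"
proof -
  obtain r where r: "strict_mono r" "monoseq (\<lambda>k. s (r k))"
    using seq_monosub by blast
  show ?thesis
  proof (cases "incseq (\<lambda>k. s (r k))")
    case True
    then show ?thesis using r that by blast
  next
    case False
    then have dec: "\<And>i j. i \<le> j \<Longrightarrow> s (r j) \<le> s (r i)"
      using r(2) unfolding monoseq_def incseq_def by blast
    obtain k where k: "\<And>j. s (r k) \<le> s (r j)"
      using ex_has_least_nat[of "\<lambda>_. True" 0 "\<lambda>k. s (r k)"] by blast
    have "s (r (j + k)) = s (r k)" for j
      by (simp add: antisym dec k)
    then have "incseq (\<lambda>j. s (r (j + k)))" by (simp add: incseq_def)
    moreover have "strict_mono (\<lambda>j. r (j + k))"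
      using r(1) by (simp add: strict_mono_def)
    ultimately show ?thesis using that by blast
  qed
qed

lemma dickson_sequence:
  fixes s :: "nat \<Rightarrow> 'n \<Rightarrow> nat"
  assumes "finite F"
  shows "\<exists>r. strict_mono r \<and> (\<forall>i\<in>F. incseq (\<lambda>k. s (r k) i))"
  using assms
proof induction
  case empty
  then show ?case using strict_mono_id by auto
next
  case (insert x F)
  then obtain r where r: "strict_mono r" "\<And>i. i \<in> F \<Longrightarrow> incseq (\<lambda>k. s (r k) i)" by blast
  obtain r' where r': "strict_mono r'" "incseq (\<lambda>k. s (r (r' k)) x)"
    using nat_incseq_subseq[of "\<lambda>k. s (r k) x"] by blast
  have "strict_mono (r \<circ> r')" using r(1) r'(1) by (rule strict_mono_o)
  moreover have "incseq (\<lambda>k. s ((r \<circ> r') k) i)" if "i \<in> insert x F" for i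
    using that r r' by (auto simp: incseq_def strict_mono_less_eq)
  ultimately show ?case by blast
qed

text \<open>
  The set \<open>B\<close> consists of the minimal elements of \<open>M\<close> for divisibility. If there were infinitely many, an
  injective sequence of them would have a subsequence that is nondecreasing in every
  exponent, and its first two members would contradict minimality.
\<close>

lemma dickson:
  fixes M :: "('n::finite \<Rightarrow>\<^sub>0 nat) set"
  shows "\<exists>B\<subseteq>M. finite B \<and> (\<forall>m\<in>M. \<exists>b\<in>B. \<exists>d. m = b + d)"
proof -
  obtain key :: "('n \<Rightarrow>\<^sub>0 nat) \<Rightarrow> nat"
    where inj: "inj key" and mult: "\<And>a b. key (a + b) = key a * key b" and pos: "\<And>a. key a > 0"
    using monomial_key_exists by blast
  define B where "B = {m\<in>M. \<forall>b\<in>M. \<forall>d. m = b + d \<longrightarrow> b = m}"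
  have "finite B"
  proof (rule ccontr)
    assume "infinite B"
    then obtain s :: "nat \<Rightarrow> _" where s: "inj s" "range s \<subseteq> B"
      using infinite_countable_subset by blast
    obtain r :: "nat \<Rightarrow> nat" where r: "strict_mono r" "\<And>i. incseq (\<lambda>k. Poly_Mapping.lookup (s (r k)) i)"
      using dickson_sequence[of "UNIV :: 'n set" "\<lambda>k. Poly_Mapping.lookup (s k)"] by auto
    have "s (r 1) = s (r 0) + (s (r 1) - s (r 0))"
      by (rule poly_mapping_eqI) (use r(2) in \<open>simp add: lookup_add lookup_minus incseq_def\<close>)
    moreover have "s (r 1) \<in> B" "s (r 0) \<in> M" using s(2) by (auto simp: B_def)
    ultimately have "s (r 0) = s (r 1)" unfolding B_def by blast
    then have "r 0 = r 1" using s(1) by (simp add: inj_eq)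
    then show False using r(1) by (metis strict_mono_eq zero_neq_one)
  qed
  moreover have "\<exists>b\<in>B. \<exists>d. m = b + d" if "m \<in> M" for m
    using that
  proof (induction "key m" arbitrary: m rule: less_induct)
    case less
    show ?case
    proof (cases "m \<in> B")
      case True
      then show ?thesis by (metis add_0_right)
    next
      case False
      then obtain b d where bd: "b \<in> M" "m = b + d" "b \<noteq> m"
        using less.prems unfolding B_def by blast
      have "key b \<le> key m" using pos[of d] by (simp add: bd(2) mult)
      moreover have "key b \<noteq> key m" using bd(3) inj by (simp add: inj_eq)
      ultimately obtain b' d' where "b' \<in> B" "b = b' + d'"
        using less.hyps[of b] bd(1) by auto
      then show ?thesis using bd(2) by (metis add.assoc)
    qed
  qed
  ultimately show ?thesis unfolding B_def by blast
qed

section \<open>Hilbert's basis theorem\<close>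

lemma lookup_single_mult:
  fixes g :: "'n mpoly"
  shows "Poly_Mapping.lookup (Poly_Mapping.single d c * g) (d + b) = c * Poly_Mapping.lookup g b"
proof (induction g rule: mpoly_induct)
  case (single m c)
  then show ?case by (simp add: mult_single lookup_single when_def)
next
  case (add p q)
  then show ?case by (simp add: distrib_left lookup_add)
qed

text \<open>
  Dickson's lemma provides finitely many elements of \<open>J\<close> such that every leading monomial of \<open>J\<close> is a multiple of
  one of theirs. These generate \<open>J\<close>: subtracting a suitable multiple of one of them
  from \<open>p \<in> J\<close> cancels the leading term of \<open>p\<close>, and the key of the leading monomial decreases.
\<close>

theorem hilbert_basis:
  fixes J :: "'n::finite mpoly set"
  assumes J: "ideal.subspace J"
  shows "\<exists>G\<subseteq>J. finite G \<and> J = ideal.span G"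
proof -
  obtain key :: "('n \<Rightarrow>\<^sub>0 nat) \<Rightarrow> nat"
    where inj: "inj key" and mult: "\<And>a b. key (a + b) = key a * key b"
    using monomial_key_exists by blast
  define leads where "leads m p \<longleftrightarrow> m \<in> Poly_Mapping.keys p \<and>
    (\<forall>k\<in>Poly_Mapping.keys p. key k \<le> key m)" for m and p :: "'n mpoly"
  have leads_ex: "\<exists>m. leads m p" if "p \<noteq> 0" for p
  proof -
    have "Poly_Mapping.keys p \<noteq> {}" using that by simp
    then have "Max (key ` Poly_Mapping.keys p) \<in> key ` Poly_Mapping.keys p"
      by (intro Max_in) auto
    then obtain m where "m \<in> Poly_Mapping.keys p" "Max (key ` Poly_Mapping.keys p) = key m" by blast
    then show ?thesis unfolding leads_def by (metis Max_ge finite_imageI finite_keys imageI)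
  qed
  define M where "M = {m. \<exists>p\<in>J. leads m p}"
  obtain B where B: "B \<subseteq> M" "finite B" "\<And>m. m \<in> M \<Longrightarrow> \<exists>b\<in>B. \<exists>d. m = b + d"
    using dickson[of M] by blast
  have "\<forall>b\<in>B. \<exists>p. p \<in> J \<and> leads b p" using B(1) by (auto simp: M_def)
  then obtain g where g: "\<And>b. b \<in> B \<Longrightarrow> g b \<in> J" "\<And>b. b \<in> B \<Longrightarrow> leads b (g b)"
    by (auto dest!: bchoice)
  have "p \<in> ideal.span (g ` B)" if "p \<in> J" "leads m p" for m p
    using that
  proof (induction "key m" arbitrary: m p rule: less_induct)
    case less
    obtain b d where b: "b \<in> B" and m: "m = b + d" using B(3) less.prems M_def by blast
    have gb: "Poly_Mapping.lookup (g b) b \<noteq> 0" using g(2)[OF b] by (simp add: leads_def in_keys_iff)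
    define c where "c = Poly_Mapping.lookup p m / Poly_Mapping.lookup (g b) b"
    define q where "q = p - Poly_Mapping.single d c * g b"
    have q: "q \<in> J"
      unfolding q_def using J g(1)[OF b] less.prems(1)
      by (intro ideal.subspace_diff ideal.subspace_scale) auto
    have "q \<in> ideal.span (g ` B)"
    proof (cases "q = 0")
      case False
      then obtain m' where m': "leads m' q" using leads_ex by blast
      then have "m' \<in> Poly_Mapping.keys p \<or> m' \<in> Poly_Mapping.keys (Poly_Mapping.single d c * g b)"
        by (auto simp: leads_def q_def lookup_minus in_keys_iff)
      then have "key m' \<le> key m"
      proof
        assume "m' \<in> Poly_Mapping.keys (Poly_Mapping.single d c * g b)"
        then obtain k where "k \<in> Poly_Mapping.keys (g b)" "m' = d + k"
          using keys_mult[of "Poly_Mapping.single d c" "g b"] by (auto split: if_splits)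
        then show ?thesis using g(2)[OF b] by (simp add: leads_def m mult)
      qed (use less.prems(2) in \<open>simp add: leads_def\<close>)
      moreover have "m' \<noteq> m"
      proof
        assume "m' = m"
        moreover have "Poly_Mapping.lookup q m = 0"
          using gb lookup_single_mult[of d c "g b" b]
          by (simp add: q_def lookup_minus c_def m add.commute)
        ultimately show False using m' by (simp add: leads_def in_keys_iff)
      qed
      ultimately have "key m' < key m" using inj by (simp add: inj_eq order_le_less)
      then show ?thesis using less.hyps q m' by blast
    qed (simp add: ideal.span_zero)
    moreover have "Poly_Mapping.single d c * g b \<in> ideal.span (g ` B)"
      using b by (intro ideal.span_scale ideal.span_base) auto
    ultimately have "q + Poly_Mapping.single d c * g b \<in> ideal.span (g ` B)"
      by (rule ideal.span_add)
    then show ?case by (simp add: q_def)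
  qed
  then have "p \<in> ideal.span (g ` B)" if "p \<in> J" for p
    using that leads_ex[of p] ideal.span_zero by (cases "p = 0") auto
  then have "J \<subseteq> ideal.span (g ` B)" by (rule subsetI)
  moreover have "ideal.span (g ` B) \<subseteq> J"
    using g(1) J by (intro ideal.span_minimal) auto
  ultimately show ?thesis using B(2) g(1) by (intro exI[of _ "g ` B"]) auto
qed

text \<open>
  The Noetherian property in the form in which it is used below: it allows both the choice of maximal
  ideals with a given property and induction on closed sets.
\<close>

lemma wf_ideal_ascending:
  "wf {(J, I :: 'n::finite mpoly set). ideal.subspace I \<and> ideal.subspace J \<and> I \<subset> J}"
  unfolding wf_iff_no_infinite_down_chain
proof
  assume "\<exists>f. \<forall>i. (f (Suc i), f i) \<in>
    {(J, I :: 'n::finite mpoly set). ideal.subspace I \<and> ideal.subspace J \<and> I \<subset> J}"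
  then obtain f :: "nat \<Rightarrow> 'n mpoly set"
    where "\<forall>i. ideal.subspace (f i) \<and> ideal.subspace (f (Suc i)) \<and> f i \<subset> f (Suc i)" by auto
  then have f: "\<And>i. ideal.subspace (f i)" "\<And>i. f i \<subset> f (Suc i)" by blast+
  have mono: "f i \<subseteq> f j" if "i \<le> j" for i j
    using lift_Suc_mono_le[of f i j] f(2) that by blast
  have "ideal.subspace (\<Union>i. f i)"
  proof (rule ideal.subspaceI)
    fix x y assume "x \<in> (\<Union>i. f i)" "y \<in> (\<Union>i. f i)"
    then obtain i j where "x \<in> f i" "y \<in> f j" by blast
    then have "x \<in> f (max i j)" "y \<in> f (max i j)" using mono[of i "max i j"] mono[of j "max i j"] by auto
    then have "x + y \<in> f (max i j)" by (rule ideal.subspace_add[OF f(1)])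
    then show "x + y \<in> (\<Union>i. f i)" by blast
  next
    show "0 \<in> (\<Union>i. f i)" using ideal.subspace_0[OF f(1)] by blast
    show "r * x \<in> (\<Union>i. f i)" if "x \<in> (\<Union>i. f i)" for r x
      using ideal.subspace_scale[OF f(1)] that by blast
  qed
  from hilbert_basis[OF this] obtain G
    where G: "G \<subseteq> (\<Union>i. f i)" "finite G" "(\<Union>i. f i) = ideal.span G"
    by (elim exE conjE)
  have "\<forall>g\<in>G. \<exists>i. g \<in> f i" using G(1) by blast
  then obtain k where k: "\<And>g. g \<in> G \<Longrightarrow> g \<in> f (k g)" by (auto dest!: bchoice)
  define n where "n = (\<Sum>g\<in>G. k g)"
  have "g \<in> f n" if "g \<in> G" for g
    using k[OF that] mono[of "k g" n] member_le_sum[of g G k] that G(2) by (auto simp: n_def)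
  then have "ideal.span G \<subseteq> f n" by (intro ideal.span_minimal f(1)) auto
  then show False using f(2)[of n] G(3) by blast
qed

text \<open>
  The generators can be taken from \<open>S\<close> itself: among the ideals spanned by finite subsets of \<open>S\<close> choose
  a maximal one.
\<close>

lemma ideal_span_finite_subset:
  fixes S :: "'n::finite mpoly set"
  shows "\<exists>G\<subseteq>S. finite G \<and> S \<subseteq> ideal.span G"
proof -
  let ?Q = "{ideal.span G | G. G \<subseteq> S \<and> finite G}"
  have "ideal.span {} \<in> ?Q" by blast
  then obtain J where J: "J \<in> ?Q"
    and max: "\<And>K. (K, J) \<in> {(J, I). ideal.subspace I \<and> ideal.subspace J \<and> I \<subset> J} \<Longrightarrow> K \<notin> ?Q"
    by (rule wfE_min[OF wf_ideal_ascending]) blast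
  then obtain G where G: "J = ideal.span G" "G \<subseteq> S" "finite G" by blast
  have "s \<in> ideal.span G" if "s \<in> S" for s
  proof -
    have "ideal.span (insert s G) \<in> ?Q" using G that by blast
    then have "\<not> ideal.span G \<subset> ideal.span (insert s G)" using max[of "ideal.span (insert s G)"] G(1) by auto
    moreover have "ideal.span G \<subseteq> ideal.span (insert s G)" by (rule ideal.span_mono) blast
    ultimately show ?thesis using ideal.span_base[of s "insert s G"] by blast
  qed
  then show ?thesis using G by blast
qed

section \<open>The Noether exponent is attained\<close>

text \<open>
  Generators are added one at a time. If \<open>g\<^bsup>k\<^esup> \<in> I\<close> and \<open>e\<close> factors from the span of \<open>G\<close> suffice, then
  \<open>k + e\<close> factors from the span of \<open>insert g G\<close> suffice: split every factor into a multiple of \<open>g\<close> and a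
  rest in the span of \<open>G\<close> and expand. In each summand either at least \<open>k\<close> factors \<open>g\<close> or at least \<open>e\<close> of
  the rests occur. Products over arbitrary index sets are needed because the rests are indexed by a
  subset.
\<close>

lemma finite_radical_subset_power:
  fixes I :: "'a::comm_ring_1 set"
  assumes I: "ideal.subspace I" and "finite G" "G \<subseteq> radical I"
  shows "\<exists>e. \<forall>(A :: nat set) h. finite A \<and> e \<le> card A \<and> (\<forall>i\<in>A. h i \<in> ideal.span G) \<longrightarrow> prod h A \<in> I"
  using assms(2,3)
proof induction
  case empty
  have "prod h A \<in> I" if A: "finite A" "1 \<le> card A" "\<forall>i\<in>A. h i \<in> ideal.span {}"
    for h and A :: "nat set"
  proof -
    have "A \<noteq> {}" using A(2) by (rule contrapos_pn) simp
    then obtain i where "i \<in> A" by blast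
    then have "prod h A = 0" using A by (intro prod_zero) auto
    then show ?thesis using ideal.subspace_0[OF I] by simp
  qed
  then show ?case by (intro exI[of _ 1] allI impI) (elim conjE)
next
  case (insert g G)
  from insert.prems have G: "G \<subseteq> radical I" by simp
  from insert.IH[OF this] obtain e
    where "\<forall>(A :: nat set) h. finite A \<and> e \<le> card A \<and> (\<forall>i\<in>A. h i \<in> ideal.span G) \<longrightarrow> prod h A \<in> I" ..
  then have e: "prod h A \<in> I" if "finite A" "e \<le> card A" "\<And>i. i \<in> A \<Longrightarrow> h i \<in> ideal.span G"
    for A :: "nat set" and h using that by simp
  obtain k where k: "g ^ k \<in> I" using insert.prems by (auto simp: radical_def)
  have "prod h A \<in> I" if A: "finite A" "k + e \<le> card A" "\<forall>i\<in>A. h i \<in> ideal.span (insert g G)"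
    for h and A :: "nat set"
  proof -
    have "\<forall>i\<in>A. \<exists>r. h i - r * g \<in> ideal.span G"
      using A(3) by (simp add: ideal.span_breakdown_eq)
    then obtain r where r: "\<And>i. i \<in> A \<Longrightarrow> h i - r i * g \<in> ideal.span G" by (auto dest!: bchoice)
    have "prod h A = (\<Prod>i\<in>A. r i * g + (h i - r i * g))" by simp
    also have "\<dots> = (\<Sum>X\<in>Pow A. (\<Prod>i\<in>X. r i * g) * (\<Prod>i\<in>A - X. h i - r i * g))"
      by (rule prod_add[OF A(1)])
    also have "\<dots> \<in> I"
    proof (rule ideal.subspace_sum[OF I])
      fix X assume X: "X \<in> Pow A"
      then have fin: "finite X" using A(1) finite_subset by blast
      show "(\<Prod>i\<in>X. r i * g) * (\<Prod>i\<in>A - X. h i - r i * g) \<in> I"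
      proof (cases "k \<le> card X")
        case True
        then have "g ^ card X = g ^ k * g ^ (card X - k)" by (simp flip: power_add)
        moreover have "(\<Prod>i\<in>X. r i * g) = g ^ card X * prod r X"
          by (simp add: prod.distrib mult.commute)
        ultimately show ?thesis using ideal_mult_right[OF I k] by (simp only: mult.assoc)
      next
        case False
        then have "e \<le> card (A - X)" using A(1,2) X fin by (simp add: card_Diff_subset)
        then have "(\<Prod>i\<in>A - X. h i - r i * g) \<in> I" by (intro e) (use A(1) r in auto)
        then show ?thesis by (rule ideal.subspace_scale[OF I])
      qed
    qed
    finally show ?thesis .
  qed
  then show ?case by (intro exI[of _ "k + e"] allI impI) (elim conjE)
qed

text \<open>
  A power of the radical lies in \<open>I\<close> because the radical is contained in the span of finitely many of
  its elements; so the set over which the least exponent is taken is not empty.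
\<close>

lemma noether_exponent_attained:
  fixes I :: "'n::finite mpoly set"
  assumes I: "ideal.subspace I"
  shows "ideal_power (radical I) (noether_exponent I) \<subseteq> I"
proof -
  obtain G where G: "G \<subseteq> radical I" "finite G" "radical I \<subseteq> ideal.span G"
    using ideal_span_finite_subset by blast
  from finite_radical_subset_power[OF I G(2,1)] obtain e
    where "\<forall>(A :: nat set) h. finite A \<and> e \<le> card A \<and> (\<forall>i\<in>A. h i \<in> ideal.span G) \<longrightarrow> prod h A \<in> I" ..
  then have e: "prod h A \<in> I" if "finite A" "e \<le> card A" "\<And>i. i \<in> A \<Longrightarrow> h i \<in> ideal.span G"
    for A :: "nat set" and h using that by simp
  have "ideal_power (radical I) (Suc e) \<subseteq> I"
    unfolding ideal_power_def ideal_gen_def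
  proof (rule ideal.span_minimal[OF _ I], safe)
    fix g :: "nat \<Rightarrow> 'n mpoly"
    assume "\<forall>i<Suc e. g i \<in> radical I"
    then have "g i \<in> ideal.span G" if "i \<in> {..<Suc e}" for i using G(3) that by blast
    then show "prod g {..<Suc e} \<in> I" by (intro e) simp_all
  qed
  then have ex: "Suc e > 0 \<and> ideal_power (radical I) (Suc e) \<subseteq> I" by simp
  show ?thesis
    using LeastI[of "\<lambda>e. e > 0 \<and> ideal_power (radical I) e \<subseteq> I", OF ex]
    unfolding noether_exponent_def by blast
qed

section \<open>Constants, variables and substitution\<close>

abbreviation mconst :: "complex \<Rightarrow> 'n mpoly"
  where "mconst c \<equiv> Poly_Mapping.single 0 c"

definition mvar :: "'n \<Rightarrow> 'n mpoly"
  where "mvar i = Poly_Mapping.single (Poly_Mapping.single i 1) 1"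

lemma mconst_mult: "mconst (a * b) = mconst a * mconst b"
  by (simp add: mult_single)

lemma mvar_power: "mvar i ^ k = Poly_Mapping.single (Poly_Mapping.single i k) 1"
  by (induction k) (simp_all add: mvar_def mult_single flip: single_add)

lemma single_eq_prod_mvar:
  fixes m :: "'n::finite \<Rightarrow>\<^sub>0 nat"
  shows "Poly_Mapping.single m c = mconst c * (\<Prod>i\<in>UNIV. mvar i ^ Poly_Mapping.lookup m i)"
proof -
  have "(\<Prod>i\<in>F. mvar i ^ Poly_Mapping.lookup m i)
      = Poly_Mapping.single (\<Sum>i\<in>F. Poly_Mapping.single i (Poly_Mapping.lookup m i)) 1"
    if "finite F" for F :: "'n set"
    using that by induction (simp_all add: mvar_power mult_single)
  moreover have "(\<Sum>i\<in>UNIV. Poly_Mapping.single i (Poly_Mapping.lookup m i)) = m"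
    by (rule poly_mapping_eqI) (simp add: lookup_sum lookup_single when_def)
  ultimately show ?thesis by (simp add: mult_single)
qed

lemma mpoly_generator_induct [case_names const var add mult]:
  fixes p :: "'n::finite mpoly"
  assumes const: "\<And>c. Q (mconst c)" and var: "\<And>i. Q (mvar i)"
    and add: "\<And>p q. Q p \<Longrightarrow> Q q \<Longrightarrow> Q (p + q)" and mult: "\<And>p q. Q p \<Longrightarrow> Q q \<Longrightarrow> Q (p * q)"
  shows "Q p"
proof (induction p rule: mpoly_induct)
  case (single m c)
  have one: "Q 1" using const[of 1] by simp
  have pow: "Q (mvar i ^ k)" for i k
    by (induction k) (simp_all add: one var mult)
  have "Q (\<Prod>i\<in>F. mvar i ^ Poly_Mapping.lookup m i)" if "finite F" for F
    using that by induction (simp_all add: one mult pow)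
  then show ?case by (subst single_eq_prod_mvar) (intro mult const, simp)
qed (rule add)

lemma eval_mpoly_const: "\<iota> 0 = 0 \<Longrightarrow> eval_mpoly \<iota> x (mconst c) = \<iota> c"
  by (simp add: eval_mpoly_single)

lemma eval_mpoly_var: "\<iota> 0 = 0 \<Longrightarrow> \<iota> 1 = 1 \<Longrightarrow> eval_mpoly \<iota> x (mvar i) = x i"
proof -
  assume "\<iota> 0 = 0" "\<iota> 1 = 1"
  moreover have "(\<Prod>j\<in>UNIV. x j ^ Poly_Mapping.lookup (Poly_Mapping.single i 1) j)
      = (\<Prod>j\<in>UNIV. if i = j then x j else 1)"
    by (rule prod.cong) (auto simp: lookup_single when_def)
  ultimately show ?thesis by (simp add: mvar_def eval_mpoly_single)
qed

lemma eval_pt_add: "eval_pt (p + q) x = eval_pt p x + eval_pt q x"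
  by (rule eval_mpoly_add) simp

lemma eval_pt_mult: "eval_pt (p * q) x = eval_pt p x * eval_pt q x"
  by (rule eval_mpoly_mult) simp_all

lemma eval_pt_diff: "eval_pt (p - q) x = eval_pt p x - eval_pt q x"
  using eval_pt_add[where p = "p - q" and q = q and x = x] by simp

text \<open>
  Substitution of a multivariate polynomial into a univariate one, a ring homomorphism that is used to
  transfer factorizations into linear factors.
\<close>

definition poly_at :: "'n mpoly \<Rightarrow> complex poly \<Rightarrow> 'n mpoly"
  where "poly_at x q = poly (map_poly mconst q) x"

lemma poly_at_0 [simp]: "poly_at x 0 = 0"
  by (simp add: poly_at_def)

lemma poly_at_pCons [simp]: "poly_at x (pCons c q) = mconst c + x * poly_at x q"
  by (simp add: poly_at_def map_poly_pCons)

lemma poly_at_add: "poly_at x (p + q) = poly_at x p + poly_at x q"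
  by (induction p q rule: poly_induct2) (simp_all add: single_add algebra_simps)

lemma poly_at_smult: "poly_at x (smult c q) = mconst c * poly_at x q"
  by (induction q) (simp_all add: mconst_mult algebra_simps)

lemma poly_at_mult: "poly_at x (p * q) = poly_at x p * poly_at x q"
  by (induction p) (simp_all add: poly_at_add poly_at_smult algebra_simps)

lemma poly_at_sum: "poly_at x (\<Sum>b\<in>B. q b) = (\<Sum>b\<in>B. poly_at x (q b))"
  by (induction B rule: infinite_finite_induct) (simp_all add: poly_at_add)

lemma poly_at_prod: "finite B \<Longrightarrow> poly_at x (\<Prod>b\<in>B. q b) = (\<Prod>b\<in>B. poly_at x (q b))"
  by (induction B rule: finite_induct) (simp_all add: poly_at_mult one_pCons)

lemma poly_at_linear: "poly_at x [:- b, 1:] = x - mconst b"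
  by (simp add: single_uminus)

section \<open>The Nullstellensatz\<close>

lemma ideal_no_const:
  fixes P :: "'n mpoly set"
  assumes "ideal.subspace P" "1 \<notin> P" "mconst c \<in> P"
  shows "c = 0"
proof (rule ccontr)
  assume "c \<noteq> 0"
  then have "mconst (1 / c) * mconst c = (1 :: 'n mpoly)" by (simp flip: mconst_mult)
  then show False using assms ideal.subspace_scale[OF assms(1,3), of "mconst (1 / c)"] by simp
qed

text \<open>
  Over the complex numbers \<open>q\<close> is a product of linear factors, and a prime ideal contains one of the factors.
\<close>

lemma prime_ideal_linear_factor:
  assumes P: "ideal.subspace P" and one: "1 \<notin> P" and prime: "\<And>y z. y * z \<in> P \<Longrightarrow> y \<in> P \<or> z \<in> P"
    and "q \<noteq> 0" "poly_at x q \<in> P"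
  shows "\<exists>b. x - mconst b \<in> P"
  using assms(4,5)
proof (induction "degree q" arbitrary: q)
  case 0
  then obtain c where c: "q = [:c:]" by (metis degree_eq_zeroE)
  then have "c = 0" using 0 ideal_no_const[OF P one, of c] by simp
  then show ?case using 0 c by simp
next
  case (Suc n)
  then have "\<not> constant (poly q)" by (simp add: constant_degree)
  then obtain z where "poly q z = 0" using fundamental_theorem_of_algebra by blast
  then obtain r where r: "q = [:- z, 1:] * r" by (auto simp: poly_eq_0_iff_dvd)
  then have "r \<noteq> 0" using Suc.prems by auto
  then have "degree q = 1 + degree r" unfolding r by (subst degree_mult_eq) auto
  then have deg: "n = degree r" using Suc.hyps(2) by simp
  have "(x - mconst z) * poly_at x r \<in> P"
    using Suc.prems(2) unfolding r poly_at_mult poly_at_linear .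
  from prime[OF this] show ?case using Suc.hyps(1)[OF deg \<open>r \<noteq> 0\<close>] by blast
qed

lemma vector_space_mpoly: "vector_space (\<lambda>c p. mconst c * p :: 'n mpoly)"
  by unfold_locales (simp_all add: algebra_simps single_add mconst_mult)

text \<open>
  The polynomials with monomials in \<open>K\<close> form a space of dimension at most \<open>card K\<close>, so an infinite family
  of them has a nontrivial relation. The family may repeat a member, and then two equal members give one.
\<close>

lemma mpoly_linear_dependence:
  fixes h :: "complex \<Rightarrow> 'n mpoly"
  assumes "infinite A" "finite K" and keys: "\<And>a. a \<in> A \<Longrightarrow> Poly_Mapping.keys (h a) \<subseteq> K"
  shows "\<exists>B c. finite B \<and> (\<exists>b\<in>B. c b \<noteq> 0) \<and> B \<subseteq> A \<and> (\<Sum>b\<in>B. mconst (c b) * h b) = 0"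
proof (cases "inj_on h A")
  case False
  then obtain a b where ab: "a \<in> A" "b \<in> A" "a \<noteq> b" "h a = h b" by (auto simp: inj_on_def)
  have "(\<Sum>y\<in>{a, b}. mconst (if y = a then 1 else - 1) * h y) = 0"
    using ab by (simp add: single_uminus)
  then show ?thesis
    using ab by (intro exI[of _ "{a, b}"] exI[of _ "\<lambda>y. if y = a then 1 else - 1"]) auto
next
  case True
  interpret mpoly: vector_space "\<lambda>c p. mconst c * p :: 'n mpoly"
    by (rule vector_space_mpoly)
  let ?T = "(\<lambda>m. Poly_Mapping.single m 1 :: 'n mpoly) ` K"
  have in_span: "h a \<in> mpoly.span ?T" if "a \<in> A" for a
  proof -
    have "h a = (\<Sum>m\<in>K. mconst (Poly_Mapping.lookup (h a) m) * Poly_Mapping.single m 1)"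
    proof (rule poly_mapping_eqI)
      fix k
      show "Poly_Mapping.lookup (h a) k = Poly_Mapping.lookup
        (\<Sum>m\<in>K. mconst (Poly_Mapping.lookup (h a) m) * Poly_Mapping.single m 1) k"
        using keys[OF that] \<open>finite K\<close>
        by (auto simp: lookup_sum mult_single lookup_single when_def in_keys_iff)
    qed
    also have "\<dots> \<in> mpoly.span ?T"
      by (intro mpoly.span_sum mpoly.span_scale mpoly.span_base) auto
    finally show ?thesis .
  qed
  have "infinite (h ` A)" using True \<open>infinite A\<close> finite_imageD by blast
  then have "mpoly.dependent (h ` A)"
    using mpoly.independent_span_bound[of ?T "h ` A"] in_span \<open>finite K\<close> by blast
  then obtain t u where t: "finite t" "t \<subseteq> h ` A" "(\<Sum>v\<in>t. mconst (u v) * v) = 0" "\<exists>v\<in>t. u v \<noteq> 0"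
    unfolding mpoly.dependent_explicit by blast
  then obtain B where B: "B \<subseteq> A" "t = h ` B" by (meson subset_imageE)
  then have inj: "inj_on h B" using True inj_on_subset by blast
  have "finite B" using t(1) B(2) inj finite_imageD by blast
  moreover have "(\<Sum>b\<in>B. mconst (u (h b)) * h b) = 0"
    using t(3) by (simp add: B(2) sum.reindex[OF inj])
  ultimately show ?thesis using t(4) B by (intro exI[of _ B] exI[of _ "\<lambda>b. u (h b)"]) auto
qed

lemma uncountable_infinite_fiber:
  assumes "uncountable A" "countable (f ` A)"
  shows "\<exists>a\<in>A. infinite {b\<in>A. f b = f a}"
proof (rule ccontr)
  assume "\<not> ?thesis"
  then have "countable (\<Union>c\<in>f ` A. {b\<in>A. f b = c})"
    using assms(2) by (intro countable_UN) (auto intro: countable_finite)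
  moreover have "(\<Union>c\<in>f ` A. {b\<in>A. f b = c}) = A" by blast
  ultimately show False using assms(1) by simp
qed

text \<open>
  Here \<open>P\<close> is maximal among the ideals that contain no power of \<open>g\<close>, so modulo \<open>P\<close> every \<open>y \<notin> P\<close> divides a
  power of \<open>g\<close>. If no \<open>x - b\<close> were in \<open>P\<close>, then for each complex \<open>a\<close> there would be \<open>h\<^sub>a\<close> with
  \<open>(x - a) h\<^sub>a \<equiv> g\<^bsup>k\<^esup>\<close>. There are uncountably many \<open>a\<close>, but only countably many exponents \<open>k\<close> and finite sets of
  monomials, so infinitely many of the \<open>h\<^sub>a\<close> share both and are linearly dependent. Clearing
  denominators in the relation between the \<open>h\<^sub>a = g\<^bsup>k\<^esup> / (x - a)\<close> yields a univariate
  \<open>q \<noteq> 0\<close> with \<open>q(x) g\<^bsup>k\<^esup> \<in> P\<close>, so that \<open>P\<close> contains a linear factor of \<open>q(x)\<close> after all.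
\<close>

lemma prime_ideal_contains_linear:
  fixes P :: "'n::finite mpoly set"
  assumes P: "ideal.subspace P" and prime: "\<And>y z. y * z \<in> P \<Longrightarrow> y \<in> P \<or> z \<in> P"
    and no: "\<And>k. g ^ k \<notin> P" and max: "\<And>y. y \<notin> P \<Longrightarrow> \<exists>k h. y * h - g ^ k \<in> P"
  shows "\<exists>b. x - mconst b \<in> P"
proof (rule ccontr)
  assume none: "\<nexists>b. x - mconst b \<in> P"
  have "\<forall>a. \<exists>k h. (x - mconst a) * h - g ^ k \<in> P"
    using max none by blast
  then obtain k h where kh: "\<And>a. (x - mconst a) * h a - g ^ k a \<in> P" by metis
  define \<phi> where "\<phi> a = (k a, Poly_Mapping.lookup ` Poly_Mapping.keys (h a))" for a
  have "countable ((UNIV :: nat set) \<times> Collect (finite :: ('n \<Rightarrow> nat) set \<Rightarrow> bool))"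
    by (intro countable_SIGMA countable_Collect_finite) auto
  then have "countable (range \<phi>)"
    by (rule countable_subset[rotated]) (auto simp: \<phi>_def)
  from uncountable_infinite_fiber[OF uncountable_UNIV_complex this]
  obtain a where inf: "infinite {b. \<phi> b = \<phi> a}" by auto
  have inj: "inj (Poly_Mapping.lookup :: ('n \<Rightarrow>\<^sub>0 nat) \<Rightarrow> _)"
    by (rule injI, rule poly_mapping_eqI) simp
  have keys: "Poly_Mapping.keys (h b) \<subseteq> Poly_Mapping.keys (h a)" if "b \<in> {b. \<phi> b = \<phi> a}" for b
    using that by (simp add: \<phi>_def inj_image_eq_iff[OF inj])
  have "\<exists>B c. finite B \<and> (\<exists>b\<in>B. c b \<noteq> 0) \<and> B \<subseteq> {b. \<phi> b = \<phi> a} \<and> (\<Sum>b\<in>B. mconst (c b) * h b) = 0"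
    by (rule mpoly_linear_dependence[OF inf finite_keys keys])
  then obtain B c
    where B: "finite B" "\<exists>b\<in>B. c b \<noteq> 0" "B \<subseteq> {b. \<phi> b = \<phi> a}"
      "(\<Sum>b\<in>B. mconst (c b) * h b) = 0"
    by (elim exE conjE)
  define q where "q = (\<Sum>b\<in>B. smult (c b) (\<Prod>l\<in>B - {b}. [:- l, 1:]))"
  have q: "poly_at x q = (\<Sum>b\<in>B. mconst (c b) * (\<Prod>l\<in>B - {b}. x - mconst l))"
    unfolding q_def poly_at_sum poly_at_smult using B(1) by (simp only: poly_at_prod finite_Diff poly_at_linear)
  (* All summands but one vanish at a point b with nonzero coefficient. *)
  have "q \<noteq> 0"
  proof -
    obtain b where b: "b \<in> B" "c b \<noteq> 0" using B(2) by blast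
    have "poly q b = (\<Sum>b'\<in>B. c b' * (\<Prod>l\<in>B - {b'}. b - l))"
      by (simp add: q_def poly_sum poly_prod)
    also have "\<dots> = (\<Sum>b'\<in>{b}. c b' * (\<Prod>l\<in>B - {b'}. b - l))"
      using B(1) b by (intro sum.mono_neutral_right) auto
    finally show ?thesis using B(1) b by (auto simp: prod_zero_iff)
  qed
  have "(\<Sum>b\<in>B. mconst (c b) * (\<Prod>l\<in>B - {b}. x - mconst l) * ((x - mconst b) * h b - g ^ k a)) \<in> P"
  proof (intro ideal.subspace_sum[OF P] ideal.subspace_scale[OF P])
    fix b assume "b \<in> B"
    then have "k b = k a" using B(3) by (auto simp: \<phi>_def)
    then show "(x - mconst b) * h b - g ^ k a \<in> P" using kh[of b] by simp
  qed
  also have "(\<Sum>b\<in>B. mconst (c b) * (\<Prod>l\<in>B - {b}. x - mconst l) * ((x - mconst b) * h b - g ^ k a))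
      = (\<Sum>b\<in>B. (\<Prod>l\<in>B. x - mconst l) * (mconst (c b) * h b)
          - mconst (c b) * (\<Prod>l\<in>B - {b}. x - mconst l) * g ^ k a)"
    by (rule sum.cong) (use B(1) in \<open>simp_all add: prod.remove[of B] algebra_simps\<close>)
  also have "\<dots> = - (poly_at x q * g ^ k a)"
    unfolding q sum_subtractf sum_distrib_right[symmetric] sum_distrib_left[symmetric] B(4) by simp
  finally have "poly_at x q * g ^ k a \<in> P"
    using ideal.subspace_neg[OF P, of "- (poly_at x q * g ^ k a)"] by simp
  then have "poly_at x q \<in> P" using prime no by blast
  moreover have "1 \<notin> P" using no[of 0] by simp
  ultimately show False using prime_ideal_linear_factor[OF P _ prime \<open>q \<noteq> 0\<close>] none by blast
qed

text \<open>
  If neither factor were in \<open>P\<close>, each would divide a power of \<open>g\<close> modulo \<open>P\<close>; then so would the product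
  \<open>y * z \<in> P\<close>, and \<open>P\<close> would contain a power of \<open>g\<close>.
\<close>

lemma ideal_avoiding_powers_prime:
  fixes P :: "'a::comm_ring_1 set"
  assumes P: "ideal.subspace P" and no: "\<And>k. g ^ k \<notin> P"
    and max: "\<And>y. y \<notin> P \<Longrightarrow> \<exists>k h. y * h - g ^ k \<in> P"
    and "y * z \<in> P"
  shows "y \<in> P \<or> z \<in> P"
proof (rule ccontr)
  assume "\<not> ?thesis"
  then have "y \<notin> P" "z \<notin> P" by blast+
  from max[OF this(1)] max[OF this(2)] obtain k h l j
    where kh: "y * h - g ^ k \<in> P" and lj: "z * j - g ^ l \<in> P" by (elim exE)
  have "y * z * (h * j) \<in> P" by (rule ideal_mult_right[OF P assms(4)])
  moreover have "(y * h - g ^ k) * (z * j) \<in> P" by (rule ideal_mult_right[OF P kh])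
  moreover have "g ^ k * (z * j - g ^ l) \<in> P" by (rule ideal.subspace_scale[OF P lj])
  ultimately have "y * z * (h * j) - (y * h - g ^ k) * (z * j) - g ^ k * (z * j - g ^ l) \<in> P"
    by (intro ideal.subspace_diff[OF P])
  also have "y * z * (h * j) - (y * h - g ^ k) * (z * j) - g ^ k * (z * j - g ^ l) = g ^ (k + l)"
    by (simp add: algebra_simps power_add)
  finally show False using no by blast
qed

text \<open>
  If no power of \<open>g\<close> is in \<open>I\<close>, enlarge \<open>I\<close> to an ideal \<open>P\<close> that is maximal with this property. It
  contains \<open>X\<^sub>i - b\<^sub>i\<close> for every variable, hence every polynomial is congruent modulo \<open>P\<close> to its value at
  \<open>b\<close>. So \<open>b\<close> is a zero of \<open>I\<close>, while \<open>g(b) = 0\<close> would give \<open>g \<in> P\<close>. Working with powers of \<open>g\<close>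
  instead of a maximal ideal gives the strong form at once, without an additional variable.
\<close>

theorem nullstellensatz:
  fixes I :: "'n::finite mpoly set"
  assumes I: "ideal.subspace I" and van: "\<And>x. x \<in> zero_set I \<Longrightarrow> eval_pt g x = 0"
  shows "g \<in> radical I"
proof (rule ccontr)
  assume not_rad: "g \<notin> radical I"
  have "g ^ k \<notin> I" for k
  proof
    assume "g ^ k \<in> I"
    then have "g ^ Suc k \<in> I" using ideal.subspace_scale[OF I, of "g ^ k" g] by simp
    then show False using not_rad by (auto simp: radical_def simp del: power_Suc)
  qed
  then have "I \<in> {J. ideal.subspace J \<and> I \<subseteq> J \<and> (\<forall>k. g ^ k \<notin> J)}" using I by simp
  then obtain P where P': "P \<in> {J. ideal.subspace J \<and> I \<subseteq> J \<and> (\<forall>k. g ^ k \<notin> J)}"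
    and max': "\<And>K. (K, P) \<in> {(J, I). ideal.subspace I \<and> ideal.subspace J \<and> I \<subset> J} \<Longrightarrow>
      K \<notin> {J. ideal.subspace J \<and> I \<subseteq> J \<and> (\<forall>k. g ^ k \<notin> J)}"
    by (rule wfE_min[OF wf_ideal_ascending]) blast
  from P' have P: "ideal.subspace P" and IP: "I \<subseteq> P" and no: "\<And>k. g ^ k \<notin> P" by blast+
  have max: "\<exists>k h. y * h - g ^ k \<in> P" if "y \<notin> P" for y
  proof -
    have "P \<subset> ideal.span (insert y P)"
      using that ideal.span_superset[of "insert y P"] by blast
    then obtain k where "g ^ k \<in> ideal.span (insert y P)"
      using max'[of "ideal.span (insert y P)"] P IP by auto
    then obtain h where "g ^ k - h * y \<in> P"
      using P by (auto simp: ideal.span_breakdown_eq ideal.span_eq_iff[THEN iffD2])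
    then have "- (g ^ k - h * y) \<in> P" by (rule ideal.subspace_neg[OF P])
    then show ?thesis by (auto simp: mult.commute)
  qed
  note prime = ideal_avoiding_powers_prime[OF P no max]
  have "\<forall>i. \<exists>b. mvar i - mconst b \<in> P"
    using prime_ideal_contains_linear[OF P prime no max] by blast
  then obtain b where b: "\<And>i. mvar i - mconst (b i) \<in> P" by metis
  define v where "v = (\<chi> i. b i)"
  have mod: "p - mconst (eval_pt p v) \<in> P" for p
  proof (induction p rule: mpoly_generator_induct)
    case (const c)
    then show ?case by (simp add: eval_mpoly_const ideal.subspace_0[OF P])
  next
    case (var i)
    then show ?case using b by (simp add: eval_mpoly_var v_def)
  next
    case (add p q)
    from ideal.subspace_add[OF P this] show ?case
      by (simp add: eval_pt_add single_add algebra_simps)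
  next
    case (mult p q)
    have "(p - mconst (eval_pt p v)) * q + mconst (eval_pt p v) * (q - mconst (eval_pt q v)) \<in> P"
      using mult by (intro ideal.subspace_add[OF P] ideal_mult_right[OF P] ideal.subspace_scale[OF P])
    then show ?case by (simp add: eval_pt_mult mconst_mult algebra_simps)
  qed
  have zero: "eval_pt p v = 0" if "p \<in> P" for p
  proof -
    have "p - (p - mconst (eval_pt p v)) \<in> P" by (intro ideal.subspace_diff[OF P] that mod)
    then show ?thesis using ideal_no_const[OF P] no[of 0] by simp
  qed
  then have "v \<in> zero_set I" using IP by (auto simp: zero_set_def)
  then have "g \<in> P" using van[of v] mod[of g] by simp
  then show False using no[of 1] by simp
qed

section \<open>Irreducible components\<close>

definition vanishing_ideal :: "(complex ^ 'n::finite) set \<Rightarrow> 'n mpoly set"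
  where "vanishing_ideal S = {p. \<forall>x\<in>S. eval_pt p x = 0}"

lemma eval_pt_zero: "eval_pt 0 x = 0"
  by (simp add: eval_mpoly_def)

lemma subspace_vanishing_ideal: "ideal.subspace (vanishing_ideal S)"
  by (rule ideal.subspaceI) (auto simp: vanishing_ideal_def eval_pt_add eval_pt_mult eval_pt_zero)

lemma zero_set_vanishing_ideal:
  assumes "closedin zariski C"
  shows "zero_set (vanishing_ideal C) = C"
proof -
  obtain F where F: "C = zero_set F" using assms unfolding closedin_zariski by blast
  then have "F \<subseteq> vanishing_ideal C" by (auto simp: vanishing_ideal_def zero_set_def)
  then have "zero_set (vanishing_ideal C) \<subseteq> C" unfolding F by (auto simp: zero_set_def)
  moreover have "C \<subseteq> zero_set (vanishing_ideal C)" by (auto simp: vanishing_ideal_def zero_set_def)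
  ultimately show ?thesis by blast
qed

text \<open>
  Closed sets satisfy the descending chain condition because passing to vanishing ideals reverses strict
  inclusions.
\<close>

lemma wf_closedin_zariski:
  "wf {(C, D :: (complex ^ 'n::finite) set). closedin zariski C \<and> closedin zariski D \<and> C \<subset> D}"
proof (rule wf_subset[OF wf_inv_image[OF wf_ideal_ascending, of vanishing_ideal]])
  have "vanishing_ideal D \<subset> vanishing_ideal C"
    if CD: "closedin zariski C" "closedin zariski D" "C \<subset> D" for C D :: "(complex ^ 'n) set"
  proof -
    have "vanishing_ideal D \<noteq> vanishing_ideal C"
      using CD zero_set_vanishing_ideal by (metis psubsetE)
    moreover have "vanishing_ideal D \<subseteq> vanishing_ideal C"
      using \<open>C \<subset> D\<close> by (auto simp: vanishing_ideal_def)
    ultimately show ?thesis by blast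
  qed
  then show "{(C, D :: (complex ^ 'n) set). closedin zariski C \<and> closedin zariski D \<and> C \<subset> D} \<subseteq>
      inv_image {(J, I). ideal.subspace I \<and> ideal.subspace J \<and> I \<subset> J} vanishing_ideal"
    by (intro subsetI) (simp add: subspace_vanishing_ideal inv_image_def split_def)
qed

lemma irreducible_variety_subset_Union:
  assumes W: "irreducible_variety W" and "finite S"
    and "\<And>C. C \<in> S \<Longrightarrow> closedin zariski C" "W \<subseteq> \<Union>S"
  shows "\<exists>C\<in>S. W \<subseteq> C"
  using assms(2-)
proof (induction S)
  case empty
  then show ?case using W by (auto simp: irreducible_variety_def)
next
  case (insert C S)
  have W': "closedin zariski W" using W by (simp add: irreducible_variety_def)
  have "closedin zariski (W \<inter> C)" using insert.prems W' by (intro closedin_Int) auto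
  moreover have "closedin zariski (W \<inter> \<Union>S)"
    using insert.prems insert.hyps W' by (intro closedin_Int closedin_Union) auto
  moreover have "W = (W \<inter> C) \<union> (W \<inter> \<Union>S)" using insert.prems by blast
  ultimately have "W = W \<inter> C \<or> W = W \<inter> \<Union>S"
    using W unfolding irreducible_variety_def by blast
  then show ?case
  proof
    assume "W = W \<inter> C"
    then show ?thesis by blast
  next
    assume "W = W \<inter> \<Union>S"
    then have "\<exists>C\<in>S. W \<subseteq> C" using insert.prems by (intro insert.IH) auto
    then show ?thesis by blast
  qed
qed

lemma finite_irreducible_decomposition:
  assumes "closedin zariski C"
  shows "\<exists>S. finite S \<and> (\<forall>W\<in>S. irreducible_variety W) \<and> \<Union>S = C"
  using wf_closedin_zariski assms
proof (induction C rule: wf_induct_rule)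
  case (less C)
  show ?case
  proof (cases "C = {} \<or> irreducible_variety C")
    case True
    then show ?thesis
    proof
      assume "C = {}"
      then show ?thesis by (intro exI[of _ "{}"]) simp
    next
      assume "irreducible_variety C"
      then show ?thesis by (intro exI[of _ "{C}"]) simp
    qed
  next
    case False
    then have "\<not> (\<forall>A B. closedin zariski A \<and> closedin zariski B \<and> C = A \<union> B \<longrightarrow> C = A \<or> C = B)"
      using less.prems unfolding irreducible_variety_def by argo
    then obtain A B where AB: "closedin zariski A" "closedin zariski B" "C = A \<union> B"
        "\<not> (C = A \<or> C = B)"
      unfolding not_all not_imp by (elim exE conjE)
    then have "A \<subset> C" "B \<subset> C" by blast+
    with AB less.prems have "\<exists>S. finite S \<and> (\<forall>W\<in>S. irreducible_variety W) \<and> \<Union>S = A"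
      "\<exists>S. finite S \<and> (\<forall>W\<in>S. irreducible_variety W) \<and> \<Union>S = B"
      by (intro less.IH; simp)+
    then obtain S T where "finite S" "\<forall>W\<in>S. irreducible_variety W" "\<Union>S = A"
      "finite T" "\<forall>W\<in>T. irreducible_variety W" "\<Union>T = B" by (elim exE conjE)
    then show ?thesis using AB(3) by (intro exI[of _ "S \<union> T"]) auto
  qed
qed

text \<open>
  The maximal members of a finite irreducible decomposition are components: an irreducible subset of \<open>V\<close>
  lies in one member of the decomposition, so nothing irreducible lies strictly above a maximal member.
\<close>

lemma finite_irreducible_components:
  assumes "closedin zariski V"
  shows "\<exists>S. finite S \<and> (\<forall>W\<in>S. irreducible_component V W) \<and> \<Union>S = V"
proof -
  obtain T where T: "finite T" "\<And>W. W \<in> T \<Longrightarrow> irreducible_variety W" "\<Union>T = V"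
    using finite_irreducible_decomposition[OF assms] by auto
  define S where "S = {W\<in>T. \<forall>W'\<in>T. W \<subseteq> W' \<longrightarrow> W = W'}"
  have "irreducible_component V W" if W: "W \<in> S" for W
    unfolding irreducible_component_def
  proof (intro conjI allI impI)
    show "irreducible_variety W" "W \<subseteq> V" using W T by (auto simp: S_def)
    fix W' assume W': "irreducible_variety W' \<and> W \<subseteq> W' \<and> W' \<subseteq> V"
    then have "\<exists>C\<in>T. W' \<subseteq> C"
      using T by (intro irreducible_variety_subset_Union) (auto simp: irreducible_variety_def)
    then obtain C where C: "C \<in> T" "W' \<subseteq> C" by blast
    then have "W = C" using W W' unfolding S_def by blast
    then show "W' = W" using C W' by blast
  qed
  moreover have "\<Union>S = V"
  proof -
    have "\<exists>M\<in>S. W \<subseteq> M" if "W \<in> T" for W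
      using finite_has_maximal2[OF T(1) that] unfolding S_def by blast
    then have "\<Union>T \<subseteq> \<Union>S" by blast
    moreover have "\<Union>S \<subseteq> \<Union>T" unfolding S_def by blast
    ultimately show ?thesis using T(3) by blast
  qed
  moreover have "finite S" using T(1) by (simp add: S_def)
  ultimately show ?thesis by blast
qed

lemma topspace_zariski_line: "topspace zariski_line = UNIV"
proof -
  have "openin zariski_line UNIV"
    unfolding openin_zariski_line by (rule exI[of _ "{1}"]) simp
  then show ?thesis using openin_subset by blast
qed

text \<open>
  If the projection is not dense, a nonzero univariate polynomial vanishes on it. Its finitely many roots
  cover \<open>W\<close> by hyperplanes, and the irreducible \<open>W\<close> lies in one of them.
\<close>

lemma coordinate_constant_if_not_free:
  assumes W: "irreducible_variety W" and "\<not> has_free_variable i W" "x \<in> W" "y \<in> W"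
  shows "x $ i = y $ i"
proof -
  let ?K = "zariski_line closure_of ((\<lambda>x. x $ i) ` W)"
  have "openin zariski_line (- ?K)"
    using closedin_closure_of[of zariski_line] by (simp add: closedin_def topspace_zariski_line Compl_eq_Diff_UNIV)
  then obtain F where F: "?K = {x. \<forall>p\<in>F. poly p x = 0}"
    unfolding openin_zariski_line compl_eq_compl_iff ..
  have "?K \<noteq> UNIV" using assms(1,2) by (simp add: has_free_variable_def)
  then obtain p where p: "p \<in> F" "p \<noteq> 0" using F by force
  define S where "S = (\<lambda>r. zero_set {mvar i - mconst r}) ` {r. poly p r = 0}"
  have zs: "zero_set {mvar i - mconst r} = {x. x $ i = r}" for r
    by (simp add: zero_set_def eval_pt_diff eval_mpoly_const eval_mpoly_var)
  have "(\<lambda>x. x $ i) ` W \<subseteq> ?K"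
    by (rule closure_of_subset) (simp add: topspace_zariski_line)
  then have "poly p (x $ i) = 0" if "x \<in> W" for x
    using that p(1) F by blast
  then have "W \<subseteq> \<Union>S" unfolding S_def zs by blast
  moreover have "finite S" unfolding S_def using poly_roots_finite[OF p(2)] by simp
  moreover have "closedin zariski C" if "C \<in> S" for C
    using that unfolding S_def closedin_zariski by blast
  ultimately obtain C where "C \<in> S" "W \<subseteq> C"
    using irreducible_variety_subset_Union[OF W] by blast
  then show ?thesis using assms(3,4) unfolding S_def zs by auto
qed

section \<open>Orders of Puiseux series\<close>

definition puiseux_regular :: "puiseux \<Rightarrow> bool"
  where "puiseux_regular a \<longleftrightarrow> (\<forall>q<0. puiseux_coeff a q = 0)"

definition puiseux_vanishes_to :: "rat \<Rightarrow> puiseux \<Rightarrow> bool"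
  where "puiseux_vanishes_to L a \<longleftrightarrow> (\<forall>q\<le>L. puiseux_coeff a q = 0)"

lemma puiseux_vanishes_to_if_ord_gt:
  assumes "puiseux_ord a > Fin L"
  shows "puiseux_vanishes_to L a"
proof (cases "a = 0")
  case True
  then show ?thesis by (simp add: puiseux_vanishes_to_def zero_puiseux.rep_eq)
next
  case False
  then obtain r where r: "puiseux_ord a = Fin r" by (simp add: puiseux_ord_def)
  then have "r > L" using assms by simp
  then show ?thesis using r unfolding puiseux_ord_eq_Fin_iff puiseux_vanishes_to_def by force
qed

lemma puiseux_coeff_mult:
  "puiseux_coeff (a * b) q =
    (\<Sum>r | puiseux_coeff a r \<noteq> 0 \<and> puiseux_coeff b (q - r) \<noteq> 0. puiseux_coeff a r * puiseux_coeff b (q - r))"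
  by (simp add: times_puiseux.rep_eq conv_def)

lemma puiseux_coeff_sum: "puiseux_coeff (\<Sum>i\<in>A. s i) q = (\<Sum>i\<in>A. puiseux_coeff (s i) q)"
  by (induction A rule: infinite_finite_induct) (simp_all add: zero_puiseux.rep_eq plus_puiseux.rep_eq)

lemma puiseux_regular_add: "puiseux_regular a \<Longrightarrow> puiseux_regular b \<Longrightarrow> puiseux_regular (a + b)"
  by (simp add: puiseux_regular_def plus_puiseux.rep_eq)

lemma puiseux_regular_mult:
  assumes "puiseux_regular a" "puiseux_regular b"
  shows "puiseux_regular (a * b)"
    and "puiseux_coeff (a * b) 0 = puiseux_coeff a 0 * puiseux_coeff b 0"
proof -
  have a: "r \<ge> 0" if "puiseux_coeff a r \<noteq> 0" for r
    using that assms(1) by (meson not_less puiseux_regular_def)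
  have b: "r \<ge> 0" if "puiseux_coeff b r \<noteq> 0" for r
    using that assms(2) by (meson not_less puiseux_regular_def)
  have empty: "{r. puiseux_coeff a r \<noteq> 0 \<and> puiseux_coeff b (q - r) \<noteq> 0} = {}" if "q < 0" for q
    using a b[of "q - _"] that by fastforce
  show "puiseux_regular (a * b)"
    unfolding puiseux_regular_def puiseux_coeff_mult by (intro allI impI) (simp only: empty sum.empty)
  have "puiseux_coeff (a * b) 0 = (\<Sum>r\<in>{0}. puiseux_coeff a r * puiseux_coeff b (0 - r))"
    unfolding puiseux_coeff_mult using a b[of "- _"] by (intro sum.mono_neutral_left) fastforce+
  then show "puiseux_coeff (a * b) 0 = puiseux_coeff a 0 * puiseux_coeff b 0" by simp
qed

lemma puiseux_vanishes_to_mult: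
  assumes "puiseux_regular a" "puiseux_vanishes_to L b"
  shows "puiseux_vanishes_to L (a * b)"
proof -
  have a: "r \<ge> 0" if "puiseux_coeff a r \<noteq> 0" for r
    using that assms(1) by (meson not_less puiseux_regular_def)
  have b: "r > L" if "puiseux_coeff b r \<noteq> 0" for r
    using that assms(2) by (meson not_less puiseux_vanishes_to_def)
  have empty: "{r. puiseux_coeff a r \<noteq> 0 \<and> puiseux_coeff b (q - r) \<noteq> 0} = {}" if "q \<le> L" for q
    using a b[of "q - _"] that by fastforce
  show ?thesis
    unfolding puiseux_vanishes_to_def puiseux_coeff_mult by (intro allI impI) (simp only: empty sum.empty)
qed

lemma puiseux_coeff_mult_monom: "puiseux_coeff (a * puiseux_monom 1 r) (q + r) = puiseux_coeff a q"
proof -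
  have "puiseux_coeff (a * puiseux_monom 1 r) (q + r)
      = (\<Sum>s\<in>{q}. puiseux_coeff a s * puiseux_coeff (puiseux_monom 1 r) (q + r - s))"
    unfolding puiseux_coeff_mult
    by (rule sum.mono_neutral_left) (auto simp: puiseux_monom.rep_eq)
  then show ?thesis by (simp add: puiseux_monom.rep_eq)
qed

lemma puiseux_monom_power: "puiseux_monom 1 r ^ k = puiseux_monom 1 (of_nat k * r)"
  by (induction k) (simp_all add: puiseux_const_one puiseux_monom_mult distrib_right)

abbreviation eval_puiseux :: "('n::finite \<Rightarrow> puiseux) \<Rightarrow> 'n mpoly \<Rightarrow> puiseux"
  where "eval_puiseux \<equiv> eval_mpoly puiseux_const"

lemma puiseux_const_zero: "puiseux_const 0 = 0"
  by transfer auto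

lemma eval_puiseux_add: "eval_puiseux \<Theta> (p + q) = eval_puiseux \<Theta> p + eval_puiseux \<Theta> q"
  by (rule eval_mpoly_add) (rule puiseux_monom_add)

lemma eval_puiseux_mult: "eval_puiseux \<Theta> (p * q) = eval_puiseux \<Theta> p * eval_puiseux \<Theta> q"
  by (rule eval_mpoly_mult) (simp_all add: puiseux_monom_add puiseux_monom_mult)

lemma eval_puiseux_const: "eval_puiseux \<Theta> (mconst c) = puiseux_const c"
  by (simp add: eval_mpoly_const puiseux_const_zero)

lemma eval_puiseux_var: "eval_puiseux \<Theta> (mvar i) = \<Theta> i"
  by (simp add: eval_mpoly_var puiseux_const_zero puiseux_const_one)

lemma eval_puiseux_power: "eval_puiseux \<Theta> (p ^ k) = eval_puiseux \<Theta> p ^ k"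
proof (induction k)
  case 0
  then show ?case using eval_puiseux_const[of \<Theta> 1] by (simp add: puiseux_const_one)
qed (simp add: eval_puiseux_mult)

text \<open>
  Series without negative exponents form a ring on which taking the constant term is a homomorphism to the
  complex numbers; so the constant term of \<open>p(\<Theta>)\<close> is the value of \<open>p\<close> at the constant terms.
\<close>

lemma eval_puiseux_regular:
  assumes "\<And>l. puiseux_regular (\<Theta> l)" "\<And>l. puiseux_coeff (\<Theta> l) 0 = \<xi> $ l"
  shows "puiseux_regular (eval_puiseux \<Theta> p) \<and> puiseux_coeff (eval_puiseux \<Theta> p) 0 = eval_pt p \<xi>"
proof (induction p rule: mpoly_generator_induct)
  case (const c)
  then show ?case
    by (simp add: eval_puiseux_const eval_mpoly_const puiseux_regular_def puiseux_monom.rep_eq)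
next
  case (var i)
  then show ?case using assms by (simp add: eval_puiseux_var eval_mpoly_var)
next
  case (add p q)
  then show ?case
    by (simp add: eval_puiseux_add eval_pt_add puiseux_regular_add plus_puiseux.rep_eq)
next
  case (mult p q)
  then show ?case by (simp add: eval_puiseux_mult eval_pt_mult puiseux_regular_mult)
qed

lemma eval_puiseux_ideal_vanishes:
  assumes reg: "\<And>p. puiseux_regular (eval_puiseux \<Theta> p)"
    and S: "\<And>p. p \<in> S \<Longrightarrow> puiseux_vanishes_to L (eval_puiseux \<Theta> p)"
    and "p \<in> ideal_gen S"
  shows "puiseux_vanishes_to L (eval_puiseux \<Theta> p)"
proof -
  have "ideal.subspace {p. puiseux_vanishes_to L (eval_puiseux \<Theta> p)}"
  proof (rule ideal.subspaceI)
    show "0 \<in> {p. puiseux_vanishes_to L (eval_puiseux \<Theta> p)}"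
      by (simp add: eval_mpoly_def puiseux_vanishes_to_def zero_puiseux.rep_eq)
  qed (auto simp: eval_puiseux_add eval_puiseux_mult puiseux_vanishes_to_mult reg,
      simp add: puiseux_vanishes_to_def plus_puiseux.rep_eq)
  then have "ideal.span S \<subseteq> {p. puiseux_vanishes_to L (eval_puiseux \<Theta> p)}"
    using S by (intro ideal.span_minimal) auto
  then show ?thesis using assms(3) unfolding ideal_gen_def by blast
qed

section \<open>Components with a free variable\<close>

theorem theorem5:
  fixes i1 :: "'n::finite"
    and m :: nat and f :: "nat \<Rightarrow> 'n mpoly"
    and \<xi> :: "complex ^ 'n"
    and N :: nat and \<gamma> :: "nat \<Rightarrow> rat" and L :: rat
    and a :: "nat \<Rightarrow> 'n \<Rightarrow> complex"
    and \<Theta> :: "'n \<Rightarrow> puiseux"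
  assumes common_zero: "\<xi> \<in> zero_set (f ` {1..m})"
    and \<gamma>_0: "\<gamma> 0 = 0"
    and \<gamma>_less: "strict_mono_on {0..N} \<gamma>"
    and \<gamma>_le: "\<gamma> N \<le> L"
    and \<Theta>_first: "\<Theta> i1 = puiseux_const (\<xi> $ i1) + puiseux_monom 1 1"
    and \<Theta>_other: "\<And>l. l \<noteq> i1 \<Longrightarrow> \<Theta> l = (\<Sum>i=0..N. puiseux_monom (a i l) (\<gamma> i))"
    and a_0: "\<And>l. l \<noteq> i1 \<Longrightarrow> a 0 l = \<xi> $ l"
    and ord_gt: "\<And>j. j \<in> {1..m} \<Longrightarrow> puiseux_ord (eval_mpoly puiseux_const \<Theta> (f j)) > Fin L"
    and not_zero: "\<exists>j\<in>{1..m}. eval_mpoly puiseux_const \<Theta> (f j) \<noteq> 0"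
    and L_ge: "L \<ge> of_nat (noether_exponent (ideal_gen (f ` {1..m})))"
  shows "\<exists>W. irreducible_component (zero_set (f ` {1..m})) W \<and> has_free_variable i1 W \<and> \<xi> \<in> W"
proof (rule ccontr)
  assume none: "\<nexists>W. irreducible_component (zero_set (f ` {1..m})) W \<and> has_free_variable i1 W \<and> \<xi> \<in> W"
  let ?V = "zero_set (f ` {1..m})" and ?I = "ideal_gen (f ` {1..m})"
  let ?e = "noether_exponent ?I"
  have I: "ideal.subspace ?I" by (simp add: ideal_gen_def)

  have "closedin zariski ?V" unfolding closedin_zariski by blast
  from finite_irreducible_components[OF this] obtain S
    where S: "finite S" "\<And>W. W \<in> S \<Longrightarrow> irreducible_component ?V W" "\<Union>S = ?V" by auto
  (* Every component through the point lies in the hyperplane where X1 - xi1 vanishes. *)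
  have fixed: "x $ i1 = \<xi> $ i1" if "W \<in> S" "\<xi> \<in> W" "x \<in> W" for W x
    using coordinate_constant_if_not_free[of W i1 x \<xi>] S(2)[OF that(1)] none that
    unfolding irreducible_component_def by blast

  (* The other components form a closed set, which some g separates from the point. *)
  have "closedin zariski (\<Union>{W\<in>S. \<xi> \<notin> W})"
    using S by (intro closedin_Union) (auto simp: irreducible_component_def irreducible_variety_def)
  then obtain F where F: "\<Union>{W\<in>S. \<xi> \<notin> W} = zero_set F" unfolding closedin_zariski ..
  have "\<xi> \<notin> zero_set F" unfolding F[symmetric] by blast
  then have "\<exists>g\<in>F. eval_pt g \<xi> \<noteq> 0" unfolding zero_set_def by simp
  then obtain g where g: "g \<in> F" "eval_pt g \<xi> \<noteq> 0" by (elim bexE)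
  define u where "u = g * (mvar i1 - mconst (\<xi> $ i1))"
  have "eval_pt u x = 0" if "x \<in> ?V" for x
  proof -
    from that have "x \<in> \<Union>S" by (simp only: S(3))
    then obtain W where W: "W \<in> S" "x \<in> W" by (elim UnionE)
    show ?thesis
    proof (cases "\<xi> \<in> W")
      case True
      then show ?thesis using fixed[OF W(1) True W(2)]
        by (simp add: u_def eval_pt_mult eval_pt_diff eval_mpoly_var eval_mpoly_const)
    next
      case False
      then have "x \<in> zero_set F" using W F by blast
      then show ?thesis using g(1) by (simp add: u_def eval_pt_mult zero_set_def)
    qed
  qed
  moreover have "zero_set ?I \<subseteq> ?V"
    using ideal.span_superset[of "f ` {1..m}"] unfolding zero_set_def ideal_gen_def by blast
  ultimately have "u \<in> radical ?I" by (intro nullstellensatz[OF I]) blast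
  then have "(\<Prod>i<?e. u) \<in> ideal_power (radical ?I) ?e"
    unfolding ideal_power_def ideal_gen_def by (intro ideal.span_base CollectI exI[of _ "\<lambda>_. u"]) simp
  then have power: "u ^ ?e \<in> ?I"
    using noether_exponent_attained[OF I] by auto

  (* The exponents start at 0, so the series have no negative exponents and constant term xi. *)
  have \<gamma>_nonneg: "\<gamma> i \<ge> 0" "\<gamma> i = 0 \<longleftrightarrow> i = 0" if "i \<in> {0..N}" for i
    using strict_mono_onD[OF \<gamma>_less, of 0 i] that \<gamma>_0 by (cases "i = 0"; simp)+
  have "puiseux_regular (\<Theta> l) \<and> puiseux_coeff (\<Theta> l) 0 = \<xi> $ l" for l
  proof (cases "l = i1")
    case True
    then show ?thesis
      by (simp add: \<Theta>_first puiseux_regular_def plus_puiseux.rep_eq puiseux_monom.rep_eq)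
  next
    case False
    have "(\<Sum>i=0..N. if \<gamma> i = 0 then a i l else 0) = (\<Sum>i=0..N. if i = 0 then a i l else 0)"
      by (rule sum.cong) (use \<gamma>_nonneg(2) in auto)
    then show ?thesis
      using \<gamma>_nonneg(1) by (fastforce simp: \<Theta>_other[OF False] a_0[OF False] puiseux_regular_def
        puiseux_coeff_sum puiseux_monom.rep_eq eq_commute[of 0] intro: sum.neutral)
  qed
  then have reg: "puiseux_regular (eval_puiseux \<Theta> p)"
    and const: "puiseux_coeff (eval_puiseux \<Theta> p) 0 = eval_pt p \<xi>" for p
    using eval_puiseux_regular[of \<Theta> \<xi> p] by blast+

  (* The order of u^e at Theta exceeds L as u^e is in the ideal, yet the coefficient at e is g(xi)^e. *)
  have "puiseux_vanishes_to L (eval_puiseux \<Theta> (u ^ ?e))"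
    by (rule eval_puiseux_ideal_vanishes[OF reg _ power]) (use ord_gt puiseux_vanishes_to_if_ord_gt in auto)
  moreover have "eval_puiseux \<Theta> (mvar i1 - mconst (\<xi> $ i1)) = puiseux_monom 1 1"
    using eval_puiseux_add[of \<Theta> "mvar i1 - mconst (\<xi> $ i1)" "mconst (\<xi> $ i1)"]
    by (simp add: eval_puiseux_var eval_puiseux_const \<Theta>_first)
  then have "eval_puiseux \<Theta> (u ^ ?e) = eval_puiseux \<Theta> (g ^ ?e) * puiseux_monom 1 (of_nat ?e)"
    by (simp add: u_def eval_puiseux_power eval_puiseux_mult power_mult_distrib puiseux_monom_power)
  then have "puiseux_coeff (eval_puiseux \<Theta> (u ^ ?e)) (0 + of_nat ?e) = eval_pt (g ^ ?e) \<xi>"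
    by (simp only: puiseux_coeff_mult_monom const)
  ultimately have "eval_pt (g ^ ?e) \<xi> = 0" using L_ge unfolding puiseux_vanishes_to_def by simp
  moreover have "eval_pt (g ^ k) \<xi> = eval_pt g \<xi> ^ k" for k
  proof (induction k)
    case 0
    then show ?case using eval_mpoly_const[of "\<lambda>c. c" _ 1] by simp
  qed (simp add: eval_pt_mult)
  ultimately show False using g(2) by simp
qed

end
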